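(* Consider the model below with exactly one changepoint ($J=1$) at location $\eta$, with sparsity $k=\|\theta_1\|_0$, $\phi=\|\theta_1\|_2$ and $\Delta=\min(\eta,n-\eta)$. Let the scores be computed from the rescaled matrix $\widetilde X = X/\sigma$ with penalty function $\lambda(t)=\lambda_0 r(t)$, and let $$\widehat\eta_\lambda = \text{the smallest maximiser over } 0<v<n \text{ of } S^v_{\lambda,(0,n]} .$$ Then there exist a universal choice of $\lambda_0>0$ and universal constants $C_0,C_1>0$ such that, whenever $$\frac{\phi^2\Delta}{\sigma^2}\ \ge\ C_0\, h(k),$$ we have $$\mathbb{P}\Big\{|\widehat\eta_\lambda-\eta|\le C_1\frac{\sigma^2}{\phi^2}h(k)\Big\}\ \ge\ 1-\frac1n .$$
   Context: Model: integers $n\ge2$, $p\ge1$, $\sigma>0$. We observe $X=\mu+W\in\mathbb{R}^{p\times n}$ where the entries $W_{i,v}$ are i.i.d. $N(0,\sigma^2)$ and $\mu\in\mathbb{R}^{p\times n}$ is deterministic with columns $\mu_v\in\mathbb{R}^p$. There are $J\ge0$ changepoints $0<\eta_1<\dots<\eta_J<n$ such that $\mu_v\ne\mu_{v+1}$ iff $v=\eta_j$ for some $j$. Let $\theta_j=\mu_{\eta_j+1}-\mu_{\eta_j}$, $\phi_j=\|\theta_j\|_2$, $k_j=\|\theta_j\|_0$ (number of nonzero entries), and $\Delta_j=\min(\eta_j-\eta_{j-1},\eta_{j+1}-\eta_j)$ with $\eta_0=0,\eta_{J+1}=n$. All logarithms are natural. CUSUM: for $y\in\mathbb{R}^n$ and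 integers $0\le s<v<e\le n$, $T^v_{(s,e]}(y)=\sqrt{\tfrac{e-v}{(e-s)(v-s)}}\sum_{t=s+1}^v y_t-\sqrt{\tfrac{v-s}{(e-s)(e-v)}}\sum_{t=v+1}^e y_t$. For an input matrix $Y$ with rows $Y_{i,\cdot}$, write $C^v_{(s,e]}(i)=T^v_{(s,e]}(Y_{i,\cdot})$. Threshold and centering: $a^2(t)=4\log\!\big(\tfrac{ep\log n}{t^2}\big)\,\mathbb{1}\{t\le (p\log n)^{1/2}\}$ (with $a(t)\ge0$), and for $a\ge0$, $\nu_a=\mathbb{E}(Z^2\mid |Z|\ge a)$ with $Z\sim N(0,1)$. For $t\in[p]$: $r(t)=(p\log n)^{1/2}$ if $t\ge(p\log n)^{1/2}$, and $r(t)=\max\{t\log(\tfrac{ep\log n}{t^2}),\log n\}$ otherwise; $h(t)=[p\max\{\log n,\log\log(ep)\}]^{1/2}$ if $t\ge(p\log n)^{1/2}$, and $h(t)=\max\{t\log(\tfrac{ep\log n}{t^2}),\log n\}$ otherwise. Candidate sparsities: $\mathcal{T}=\{2^m: m\ge0,\ 2^m\le \lfloor (p\log n)^{1/2}\rfloor\}\cup\{p\}$. Penalized score: for a penalty function $g:[p]\to\mathbb{R}$, $S^v_{g,(s,e]}(t)=\sum_{i=1}^p\{C^v_{(s,e]}(i)^2-\nu_{a(t)}\}\mathbb{1}\{|C^v_{(s,e]}(i)|\ge a(t)\}-g(t)$ and $S^v_{g,(s,e]}=\max_{t\in\mathcal{T}}S^v_{g,(s,e]}(t)$. *)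

theory Defs
  imports "HOL-Probability.Probability"
begin

(* Rows are indexed by i \<in> {1..p}, columns (time points) by v \<in> {1..n}.
   Matrices are functions nat \<Rightarrow> nat \<Rightarrow> real. *)

definition cusum :: "(nat \<Rightarrow> real) \<Rightarrow> nat \<Rightarrow> nat \<Rightarrow> nat \<Rightarrow> real" where
  "cusum y s v e =
     sqrt ((real e - real v) / ((real e - real s) * (real v - real s))) * (\<Sum>t\<in>{s+1..v}. y t)
   - sqrt ((real v - real s) / ((real e - real s) * (real e - real v))) * (\<Sum>t\<in>{v+1..e}. y t)"

definition cusum_row :: "(nat \<Rightarrow> nat \<Rightarrow> real) \<Rightarrow> nat \<Rightarrow> nat \<Rightarrow> nat \<Rightarrow> nat \<Rightarrow> real" where
  "cusum_row Y s v e i = cusum (Y i) s v e"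

definition thr :: "nat \<Rightarrow> nat \<Rightarrow> real \<Rightarrow> real" where
  "thr p n t = sqrt (4 * ln (exp 1 * real p * ln (real n) / t\<^sup>2) *
                     (if t \<le> sqrt (real p * ln (real n)) then 1 else 0))"

(* \<nu>_a = E(Z^2 | |Z| \<ge> a), Z standard normal *)
definition nu :: "real \<Rightarrow> real" where
  "nu a = (LINT z:{z. \<bar>z\<bar> \<ge> a}|lborel. z\<^sup>2 * std_normal_density z) /
          (LINT z:{z. \<bar>z\<bar> \<ge> a}|lborel. std_normal_density z)"

definition rfun :: "nat \<Rightarrow> nat \<Rightarrow> real \<Rightarrow> real" where
  "rfun p n t = (if t \<ge> sqrt (real p * ln (real n)) then sqrt (real p * ln (real n))
                 else max (t * ln (exp 1 * real p * ln (real n) / t\<^sup>2)) (ln (real n)))"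

definition hfun :: "nat \<Rightarrow> nat \<Rightarrow> real \<Rightarrow> real" where
  "hfun p n t = (if t \<ge> sqrt (real p * ln (real n))
                 then sqrt (real p * max (ln (real n)) (ln (ln (exp 1 * real p))))
                 else max (t * ln (exp 1 * real p * ln (real n) / t\<^sup>2)) (ln (real n)))"

definition cand :: "nat \<Rightarrow> nat \<Rightarrow> nat set" where
  "cand p n = {2 ^ m | m. real (2 ^ m) \<le> real_of_int \<lfloor>sqrt (real p * ln (real n))\<rfloor>} \<union> {p}"

definition score_t :: "nat \<Rightarrow> nat \<Rightarrow> (nat \<Rightarrow> real) \<Rightarrow> (nat \<Rightarrow> nat \<Rightarrow> real)
                       \<Rightarrow> nat \<Rightarrow> nat \<Rightarrow> nat \<Rightarrow> nat \<Rightarrow> real" where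
  "score_t p n g Y s v e t =
     (\<Sum>i\<in>{1..p}. (if \<bar>cusum_row Y s v e i\<bar> \<ge> thr p n (real t)
                    then (cusum_row Y s v e i)\<^sup>2 - nu (thr p n (real t)) else 0)) - g t"

definition score :: "nat \<Rightarrow> nat \<Rightarrow> (nat \<Rightarrow> real) \<Rightarrow> (nat \<Rightarrow> nat \<Rightarrow> real)
                     \<Rightarrow> nat \<Rightarrow> nat \<Rightarrow> nat \<Rightarrow> real" where
  "score p n g Y s v e = Max ((\<lambda>t. score_t p n g Y s v e t) ` cand p n)"

definition eta_hat :: "nat \<Rightarrow> nat \<Rightarrow> (nat \<Rightarrow> real) \<Rightarrow> (nat \<Rightarrow> nat \<Rightarrow> real) \<Rightarrow> nat" where
  "eta_hat p n g Y = (LEAST v. 0 < v \<and> v < n \<and>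
        (\<forall>w. 0 < w \<and> w < n \<longrightarrow> score p n g Y 0 w n \<le> score p n g Y 0 v n))"

definition noise_measure :: "nat \<Rightarrow> nat \<Rightarrow> real \<Rightarrow> (nat \<times> nat \<Rightarrow> real) measure" where
  "noise_measure p n \<sigma> = PiM ({1..p} \<times> {1..n}) (\<lambda>_. density lborel (normal_density 0 \<sigma>))"

end

theory Submission
  imports Defs
begin

text \<open>
  Write the CUSUM of the rescaled data as \<open>C v i = - c v * th i + Z v i\<close> with independent standard normal
  \<open>Z v i\<close> over the rows and \<open>th = \<theta> / \<sigma>\<close>. The signal loss \<open>gap v = |th|\<^sup>2 * ((c \<eta>)\<^sup>2 - (c v)\<^sup>2)\<close> is at least
  \<open>|th|\<^sup>2 * min |v - \<eta>| \<Delta> / 2\<close>, and \<open>(c \<eta>)\<^sup>2 - (c v)\<^sup>2\<close> is also the squared norm of \<open>c \<eta> \<psi>\<^sub>\<eta> - c v \<psi>\<^sub>v\<close> for the CUSUM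
  weight vectors \<open>\<psi>\<close>. Hence the part of \<open>\<Sum>i. (C \<eta> i)\<^sup>2 - (C v i)\<^sup>2\<close> that is linear in the noise has
  variance of order \<open>gap v\<close> and costs at most \<open>gap v / 2 + O(log n)\<close>. It remains to see that all other
  differences between the score and the sum of squares are \<open>O(h(k))\<close>; then a maximiser \<open>v\<close> has
  \<open>gap v = O(h(k))\<close>.

  If \<open>k \<le> (p log n)\<^sup>1\<^sup>/\<^sup>2\<close>, thresholding changes the \<open>k\<close> coordinates of the support by at most
  \<open>k * O(a(k)\<^sup>2) = O(h(k))\<close>, and outside the support the score is pure noise, which a Chernoff bound
  puts below the penalty \<open>\<lambda>(t)\<close> up to \<open>O(log n)\<close>, uniformly in \<open>v\<close> and \<open>t\<close>.

  If \<open>k > (p log n)\<^sup>1\<^sup>/\<^sup>2\<close>, the score at \<open>\<eta>\<close> is bounded below through \<open>t = p\<close>, where there is no thresholding.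
  At any other \<open>t\<close> the thresholded sum exceeds \<open>\<Sum>i. (C v i)\<^sup>2 - 1\<close> by a sum of bounded terms
  that decrease in \<open>|C v i|\<close>; as a shift makes a centred normal variable stochastically larger in absolute
  value, the exponential moments are largest for \<open>th = 0\<close>, where Jensen's inequality compares them with
  those of \<open>1 - Z\<^sup>2\<close>. The union over the \<open>O(log (e p))\<close> candidates \<open>t\<close> is what brings
  \<open>log log (e p)\<close> into \<open>h\<close>.
\<close>

section \<open>Truncated second moments of the standard normal distribution\<close>

text \<open>The tilt turns the density into \<open>s\<close> times the centred normal density of
  standard deviation \<open>s = 1 / sqrt (1 - 2 * b)\<close>, so the integral is
  \<open>s\<close>.\<close>

lemma std_normal_exp_square:
  fixes b :: real assumes "b < 1/2"
  shows "has_bochner_integral lborel (\<lambda>z. exp (b * z\<^sup>2) * std_normal_density z) (1 / sqrt (1 - 2 * b))"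
proof -
  define s where "s = 1 / sqrt (1 - 2*b)"
  have s: "s > 0" "s\<^sup>2 = 1 / (1 - 2*b)" using assms by (auto simp: s_def power_divide)
  have e: "exp (b * z\<^sup>2) * std_normal_density z = s * normal_density 0 s z" for z
  proof -
    have "b * z\<^sup>2 - z\<^sup>2/2 = - (z\<^sup>2 / (2 * s\<^sup>2))"
      using assms by (simp add: s field_simps)
    then have "exp (b * z\<^sup>2) * exp (- (z\<^sup>2/2)) = exp (- (z\<^sup>2 / (2 * s\<^sup>2)))"
      by (simp add: exp_add[symmetric])
    then show ?thesis using s(1)
      by (simp add: normal_density_def real_sqrt_mult)
  qed
  have "has_bochner_integral lborel (\<lambda>z. s * normal_density 0 s z) (s * 1)"
    using s by (intro has_bochner_integral_mult_right) (auto simp: has_bochner_integral_iff integral_normal_density)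
  then show ?thesis unfolding e[symmetric] by (simp add: s_def)
qed

lemma std_normal_second_moment:
  "has_bochner_integral lborel (\<lambda>z. z\<^sup>2 * std_normal_density z) 1"
  using integral_std_normal_moment_even[of 1] std_normal_moment_even[of 1]
  by (simp add: mult.commute fact_numeral)

lemma std_normal_integrable_square [simp]: "integrable lborel (\<lambda>z. z\<^sup>2 * std_normal_density z)"
  using std_normal_second_moment by (simp add: has_bochner_integral_iff)

definition tail_set :: "real \<Rightarrow> real set" where "tail_set a = {z. a \<le> \<bar>z\<bar>}"

lemma tail_set_borel [measurable, simp]: "tail_set a \<in> sets borel"
  unfolding tail_set_def by measurable

text \<open>A vanishing integral would make the tail set null, although it contains an interval of
  length 1. The quotient in \<open>nu\<close> is thus a genuine conditional expectation.\<close>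

lemma tail_prob_pos: "0 < (LINT z:tail_set a|lborel. std_normal_density z)"
proof -
  have i: "set_integrable lborel (tail_set a) std_normal_density"
    by (rule set_integrable_subset[of _ UNIV]) (auto simp: set_integrable_def)
  have "0 \<le> (LINT z:tail_set a|lborel. std_normal_density z)"
    unfolding set_lebesgue_integral_def by (intro Bochner_Integration.integral_nonneg) (auto simp: indicator_def)
  moreover have "(LINT z:tail_set a|lborel. std_normal_density z) \<noteq> 0"
  proof
    assume "(LINT z:tail_set a|lborel. std_normal_density z) = 0"
    then have "AE z in lborel. indicator (tail_set a) z *\<^sub>R std_normal_density z = 0"
      using i unfolding set_lebesgue_integral_def set_integrable_def
      by (subst (asm) integral_nonneg_eq_0_iff_AE) (auto simp: indicator_def)
    then have "AE z in lborel. z \<notin> tail_set a"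
      by eventually_elim (use less_imp_neq[OF normal_density_pos[of 1 0], THEN not_sym] in \<open>force simp: indicator_def split: if_splits\<close>)
    then have "tail_set a \<in> null_sets lborel"
      by (subst (asm) AE_iff_null_sets[symmetric]) auto
    then have "{\<bar>a\<bar>..\<bar>a\<bar>+1} \<in> null_sets lborel"
      by (rule null_sets_subset) (auto simp: tail_set_def)
    then show False by (simp add: null_sets_def)
  qed
  ultimately show ?thesis by simp
qed

lemma nu_eq: "nu a * (LINT z:tail_set a|lborel. std_normal_density z) = (LINT z:tail_set a|lborel. z\<^sup>2 * std_normal_density z)"
  using tail_prob_pos[of a] by (simp add: nu_def tail_set_def)

lemma set_integrable_tail:
  "set_integrable lborel (tail_set a) std_normal_density"
  "set_integrable lborel (tail_set a) (\<lambda>z. z\<^sup>2 * std_normal_density z)"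
  by (rule set_integrable_subset[of _ UNIV]; auto simp: set_integrable_def)+

lemma nu_ge: assumes "0 \<le> a" shows "a\<^sup>2 \<le> nu a"
proof -
  have "a\<^sup>2 * (LINT z:tail_set a|lborel. std_normal_density z) = (LINT z:tail_set a|lborel. a\<^sup>2 * std_normal_density z)"
    by simp
  also have "\<dots> \<le> (LINT z:tail_set a|lborel. z\<^sup>2 * std_normal_density z)"
    by (rule set_integral_mono) (use set_integrable_tail assms in \<open>auto simp: tail_set_def intro!: mult_right_mono dest: power_mono[where n=2]\<close>)
  also have "\<dots> = nu a * (LINT z:tail_set a|lborel. std_normal_density z)" by (simp add: nu_eq)
  finally show ?thesis using tail_prob_pos[of a] by simp
qed

lemma nu_nonneg: "0 \<le> a \<Longrightarrow> 0 \<le> nu a"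
  using nu_ge[of a] by (meson order_trans zero_le_power2)

lemma nu_0: "nu 0 = 1"
  using std_normal_second_moment
  by (simp add: nu_def set_lebesgue_integral_def has_bochner_integral_iff integral_normal_density)

text \<open>The substitution \<open>z = 2 * w\<close> compares the part of the integral beyond \<open>2 * a\<close> with the tail probability beyond \<open>a\<close>.\<close>

lemma nu_le: assumes "0 \<le> a" shows "nu a \<le> 4 * a\<^sup>2 + 8"
proof -
  let ?q = "LINT z:tail_set a|lborel. std_normal_density z"
  let ?f = "\<lambda>z. indicator (tail_set (2*a)) z *\<^sub>R (z\<^sup>2 * std_normal_density z)"
  have iA: "integrable lborel (\<lambda>z. indicator (tail_set a) z *\<^sub>R std_normal_density z)"
    and iB: "integrable lborel ?f"
    and iC: "integrable lborel (\<lambda>z. indicator (tail_set a) z *\<^sub>R (z\<^sup>2 * std_normal_density z))"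
    using set_integrable_tail unfolding set_integrable_def by auto
  have sub: "(\<integral>z. ?f z \<partial>lborel) = 2 * (\<integral>w. ?f (2 * w) \<partial>lborel)"
    using lborel_integral_real_affine[of 2 ?f 0] by simp
  have iB': "integrable lborel (\<lambda>w. ?f (2 * w))"
    using lborel_integrable_real_affine[OF iB, of 2 0] by simp
  have "(\<integral>w. ?f (2 * w) \<partial>lborel) \<le> (\<integral>w. 4 * (indicator (tail_set a) w *\<^sub>R std_normal_density w) \<partial>lborel)"
  proof (rule integral_mono[OF iB' integrable_mult_right[OF iA]])
    fix w :: real
    have "w\<^sup>2 * exp (- (2*w)\<^sup>2/2) \<le> exp (- w\<^sup>2/2)"
    proof -
      have "w\<^sup>2 \<le> exp (w\<^sup>2)" using exp_ge_add_one_self[of "w\<^sup>2"] by linarith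
      also have "\<dots> \<le> exp (3/2 * w\<^sup>2)" by simp
      finally have "w\<^sup>2 * exp (- (2*w)\<^sup>2/2) \<le> exp (3/2*w\<^sup>2) * exp (- (2*w)\<^sup>2/2)" by (rule mult_right_mono) simp
      also have "\<dots> = exp (- w\<^sup>2/2)" by (simp add: exp_add[symmetric] power_mult_distrib)
      finally show ?thesis .
    qed
    then have "(2*w)\<^sup>2 * std_normal_density (2*w) \<le> 4 * std_normal_density w"
      by (simp add: std_normal_density_def power_mult_distrib divide_right_mono)
    then show "?f (2*w) \<le> 4 * (indicator (tail_set a) w *\<^sub>R std_normal_density w)"
      by (auto simp: indicator_def tail_set_def abs_mult)
  qed
  then have B: "(\<integral>z. ?f z \<partial>lborel) \<le> 8 * ?q"
    using sub by (simp add: set_lebesgue_integral_def)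
  have "nu a * ?q = (\<integral>z. indicator (tail_set a) z *\<^sub>R (z\<^sup>2 * std_normal_density z) \<partial>lborel)"
    unfolding nu_eq by (simp add: set_lebesgue_integral_def)
  \<comment> \<open>Below \<open>2 * a\<close> the square is at most \<open>4 * a\<^sup>2\<close>;
    what lies beyond is left to \<open>?f\<close>.\<close>
  also have "\<dots> \<le> (\<integral>z. (4*a\<^sup>2) * (indicator (tail_set a) z *\<^sub>R std_normal_density z) + ?f z \<partial>lborel)"
  proof (rule integral_mono[OF iC])
    show "integrable lborel (\<lambda>z. (4*a\<^sup>2) * (indicator (tail_set a) z *\<^sub>R std_normal_density z) + ?f z)"
      using iA iB by auto
    fix z :: real
    show "indicator (tail_set a) z *\<^sub>R (z\<^sup>2 * std_normal_density z)
      \<le> (4*a\<^sup>2) * (indicator (tail_set a) z *\<^sub>R std_normal_density z) + ?f z"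
    proof (cases "2*a \<le> \<bar>z\<bar>")
      case False
      then have "\<bar>z\<bar>\<^sup>2 \<le> (2*a)\<^sup>2" by (intro power_mono) auto
      then have "z\<^sup>2 * std_normal_density z \<le> (4*a\<^sup>2) * std_normal_density z"
        by (intro mult_right_mono) (auto simp: power_mult_distrib)
      then show ?thesis using False by (auto simp: indicator_def tail_set_def)
    qed (auto simp: indicator_def tail_set_def)
  qed
  also have "\<dots> = (4*a\<^sup>2) * ?q + (\<integral>z. ?f z \<partial>lborel)"
    using iA iB by (simp add: set_lebesgue_integral_def)
  also have "\<dots> \<le> (4*a\<^sup>2+8) * ?q" using B by (simp add: distrib_right)
  finally show ?thesis using tail_prob_pos[of a] by simp
qed

section \<open>Exponential moments of a thresholded coordinate\<close>

definition excess :: "real \<Rightarrow> real \<Rightarrow> real" where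
  "excess a z = (if a \<le> \<bar>z\<bar> then z\<^sup>2 - nu a else 0)"

text \<open>What thresholding adds to the plain summand \<open>z\<^sup>2 - 1\<close>. For
  \<open>0 \<le> a\<close> it is at most 1 and decreases in \<open>\<bar>z\<bar>\<close>, so its
  exponential moments can be controlled under any shift.\<close>

definition defect :: "real \<Rightarrow> real \<Rightarrow> real" where
  "defect a z = 1 - (if a \<le> \<bar>z\<bar> then nu a else z\<^sup>2)"

lemma excess_eq: "excess a z = z\<^sup>2 - 1 + defect a z"
  by (simp add: excess_def defect_def)

lemma excess_measurable [measurable]: "excess a \<in> borel_measurable borel"
  unfolding excess_def by measurable

lemma defect_measurable [measurable]: "defect a \<in> borel_measurable borel"
  unfolding defect_def by measurable

text \<open>This is the purpose of \<open>nu\<close>: centring the thresholded square removes the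
  first-order term of the exponential moment.\<close>

lemma excess_mean: "has_bochner_integral lborel (\<lambda>z. excess a z * std_normal_density z) 0"
proof -
  have e: "excess a z * std_normal_density z = indicator (tail_set a) z *\<^sub>R (z\<^sup>2 * std_normal_density z)
      - nu a * (indicator (tail_set a) z *\<^sub>R std_normal_density z)" for z
    by (auto simp: excess_def indicator_def tail_set_def algebra_simps)
  have "has_bochner_integral lborel (\<lambda>z. indicator (tail_set a) z *\<^sub>R (z\<^sup>2 * std_normal_density z)
      - nu a * (indicator (tail_set a) z *\<^sub>R std_normal_density z)) 
     ((LINT z:tail_set a|lborel. z\<^sup>2 * std_normal_density z) - nu a * (LINT z:tail_set a|lborel. std_normal_density z))"
    unfolding set_lebesgue_integral_def
    by (intro has_bochner_integral_diff has_bochner_integral_mult_right has_bochner_integral_integrable)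
      (use set_integrable_tail in \<open>auto simp: set_integrable_def\<close>)
  then show ?thesis by (simp add: nu_eq e)
qed

lemma exp_le_quadratic: "exp u \<le> 1 + u + u\<^sup>2 * exp \<bar>u\<bar>" for u :: real
proof -
  obtain t where t: "\<bar>t\<bar> \<le> \<bar>u\<bar>" "exp u = (\<Sum>m<2. u ^ m / fact m) + exp t / fact 2 * u ^ 2"
    using Maclaurin_exp_le[of u 2] by auto
  have "exp t / 2 * u\<^sup>2 \<le> exp \<bar>u\<bar> * u\<^sup>2"
    using t(1) by (intro mult_right_mono) (auto intro: order_trans[of _ "exp \<bar>u\<bar>"])
  then show ?thesis using t(2) by (simp add: numeral_2_eq_2 mult.commute)
qed

lemma square_exp_le: "y\<^sup>2 * exp \<bar>y\<bar> \<le> 2 * exp (2 * \<bar>y\<bar>)" for y :: real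
proof -
  have "y\<^sup>2 / 2 \<le> exp \<bar>y\<bar>"
    using exp_lower_Taylor_quadratic[of "\<bar>y\<bar>"] by simp
  then have "y\<^sup>2 * exp \<bar>y\<bar> \<le> (2 * exp \<bar>y\<bar>) * exp \<bar>y\<bar>" by (intro mult_right_mono) auto
  then show ?thesis by (simp only: mult_2 exp_add mult.assoc distrib_right)
qed

text \<open>Rounds up \<open>2 * 64\<^sup>2 * 2 * 2 = 32768\<close> from the end of
  \<open>excess_mgf\<close>. The quotient by \<open>64\<^sup>2\<close> stays below 10, on which the
  Chernoff bounds rely.\<close>

abbreviation (input) "mgf_const \<equiv> 40000 :: real"

text \<open>The linear Taylor term has mean 0. The quadratic remainder is present only for
  \<open>a \<le> \<bar>z\<bar>\<close>, where Gaussian decay can be traded for the factor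
  \<open>exp (- a\<^sup>2/4)\<close>: a high threshold leaves a small variance proxy.\<close>

lemma excess_mgf:
  assumes a: "0 \<le> a" and s: "\<bar>s\<bar> \<le> 1/64"
  shows "(\<integral>\<^sup>+z. exp (s * excess a z) * std_normal_density z \<partial>lborel) \<le> exp (mgf_const * s\<^sup>2 * exp (- a\<^sup>2/4))"
proof -
  let ?c = "s\<^sup>2 * (2 * 64\<^sup>2 * exp (1/4) * exp (- a\<^sup>2/4))"
  have pt: "exp (s * excess a z) \<le> 1 + s * excess a z + ?c * exp (3/8 * z\<^sup>2)" for z
  proof (cases "a \<le> \<bar>z\<bar>")
    case True
    define Y where "Y = excess a z"
    have az: "a\<^sup>2 \<le> z\<^sup>2" using power_mono[OF True a, of 2] by simp
    have Y: "\<bar>Y\<bar> \<le> 4 * z\<^sup>2 + 8"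
      using nu_le[OF a] nu_nonneg[OF a] az True unfolding Y_def excess_def by (simp add: abs_le_iff) (smt (verit) zero_le_power2)
    have "(s*Y)\<^sup>2 * exp \<bar>s*Y\<bar> \<le> s\<^sup>2 * (Y\<^sup>2 * exp (\<bar>Y\<bar>/64))"
    proof -
      have "\<bar>s*Y\<bar> \<le> \<bar>Y\<bar>/64" using mult_right_mono[OF s, of "\<bar>Y\<bar>"] by (simp add: abs_mult)
      then show ?thesis by (simp add: power_mult_distrib mult.assoc mult_left_mono)
    qed
    also have "Y\<^sup>2 * exp (\<bar>Y\<bar>/64) = 64\<^sup>2 * ((Y/64)\<^sup>2 * exp \<bar>Y/64\<bar>)" by (simp add: power_divide)
    also have "\<dots> \<le> 64\<^sup>2 * (2 * exp (2 * \<bar>Y/64\<bar>))" by (intro mult_left_mono square_exp_le) auto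
    \<comment> \<open>The left side is at most \<open>1/4 + z\<^sup>2/8\<close>. Writing
      \<open>1/8 = 3/8 - 1/4\<close> and using \<open>a\<^sup>2 \<le> z\<^sup>2\<close> extracts the
      decay in \<open>a\<close>, while \<open>3/8\<close> stays below the integrability limit
      \<open>1/2\<close>.\<close>
    also have "2 * \<bar>Y/64\<bar> \<le> 1/4 + - a\<^sup>2/4 + 3/8*z\<^sup>2" using Y az by simp
    finally have "(s*Y)\<^sup>2 * exp \<bar>s*Y\<bar> \<le> s\<^sup>2 * (64\<^sup>2 * (2 * exp (1/4 + - a\<^sup>2/4 + 3/8*z\<^sup>2)))"
      by (simp add: mult_left_mono)
    then have "(s*Y)\<^sup>2 * exp \<bar>s*Y\<bar> \<le> ?c * exp (3/8*z\<^sup>2)" by (simp only: exp_add mult_ac)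
    then show ?thesis using exp_le_quadratic[of "s*Y"] unfolding Y_def by linarith
  qed (simp add: excess_def)
  have I: "has_bochner_integral lborel (\<lambda>z. std_normal_density z + s * (excess a z * std_normal_density z)
      + ?c * (exp (3/8 * z\<^sup>2) * std_normal_density z)) (1 + s * 0 + ?c * (1 / sqrt (1 - 2 * (3/8))))"
    by (intro has_bochner_integral_add has_bochner_integral_mult_right excess_mean std_normal_exp_square)
      (auto simp: has_bochner_integral_iff integral_normal_density)
  have le: "exp (s * excess a z) * std_normal_density z \<le> std_normal_density z + s * (excess a z * std_normal_density z)
      + ?c * (exp (3/8 * z\<^sup>2) * std_normal_density z)" for z
    using mult_right_mono[OF pt[of z], of "std_normal_density z"] by (simp add: algebra_simps)
  have nn: "0 \<le> std_normal_density z + s * (excess a z * std_normal_density z)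
      + ?c * (exp (3/8 * z\<^sup>2) * std_normal_density z)" for z
    by (rule order_trans[OF _ le]) simp
  have "(\<integral>\<^sup>+z. exp (s * excess a z) * std_normal_density z \<partial>lborel)
     \<le> (\<integral>\<^sup>+z. ennreal (std_normal_density z + s * (excess a z * std_normal_density z)
      + ?c * (exp (3/8 * z\<^sup>2) * std_normal_density z)) \<partial>lborel)"
    by (intro nn_integral_mono ennreal_leI le)
  also have "\<dots> = ennreal (1 + s * 0 + ?c * (1 / sqrt (1 - 2 * (3/8))))"
    using I by (subst nn_integral_eq_integral) (use nn in \<open>auto simp: has_bochner_integral_iff simp del: times_divide_eq_left\<close>)
  also have "1 + s * 0 + ?c * (1 / sqrt (1 - 2 * (3/8))) \<le> 1 + mgf_const * s\<^sup>2 * exp (- a\<^sup>2/4)"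
  proof -
    have sq: "sqrt (1 - 2 * (3/8)) = (1/2::real)" by (rule real_sqrt_unique) (auto simp: power2_eq_square)
    have "?c * (1 / sqrt (1 - 2 * (3/8))) = ?c * 2" unfolding sq by simp
    moreover have "exp (1/4::real) \<le> 2" using exp_bound[of "1/4::real"] by (simp add: power2_eq_square)
    then have "?c * 2 \<le> s\<^sup>2 * (2 * 64\<^sup>2 * 2 * exp (- a\<^sup>2/4)) * 2"
      by (intro mult_right_mono mult_left_mono) auto
    moreover have "\<dots> \<le> mgf_const * s\<^sup>2 * exp (- a\<^sup>2/4)" by (simp add: mult_ac mult_left_mono)
    ultimately show ?thesis by linarith
  qed
  also have "\<dots> \<le> exp (mgf_const * s\<^sup>2 * exp (- a\<^sup>2/4))" by (rule exp_ge_add_one_self)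
  finally show ?thesis by (simp add: ennreal_leI)
qed

lemma (in prob_space) exp_markov:
  fixes G :: "'a \<Rightarrow> real"
  assumes [measurable]: "G \<in> borel_measurable M" and E: "(\<integral>\<^sup>+x. ennreal (exp (G x)) \<partial>M) \<le> ennreal (exp b)"
  shows "prob {x \<in> space M. y \<le> G x} \<le> exp (b - y)"
proof -
  have "emeasure M {x \<in> space M. y \<le> G x} \<le> emeasure M {x \<in> space M. 1 \<le> ennreal (exp (-y)) * ennreal (exp (G x))}"
  proof (rule emeasure_mono)
    show "{x \<in> space M. y \<le> G x} \<subseteq> {x \<in> space M. 1 \<le> ennreal (exp (-y)) * ennreal (exp (G x))}"
      by (auto simp: ennreal_mult[symmetric] exp_add[symmetric] simp flip: ennreal_1)
  qed measurable
  also have "\<dots> \<le> ennreal (exp (-y)) * (\<integral>\<^sup>+x. ennreal (exp (G x)) * indicator (space M) x \<partial>M)"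
    using nn_integral_Markov_inequality[of "\<lambda>x. ennreal (exp (G x))" "space M" M "ennreal (exp (-y))"] by simp
  also have "(\<integral>\<^sup>+x. ennreal (exp (G x)) * indicator (space M) x \<partial>M) = (\<integral>\<^sup>+x. ennreal (exp (G x)) \<partial>M)"
    by (rule nn_integral_cong) simp
  also have "ennreal (exp (-y)) * \<dots> \<le> ennreal (exp (-y)) * ennreal (exp b)"
    by (intro mult_left_mono E) simp
  also have "\<dots> = ennreal (exp (b - y))" by (simp add: ennreal_mult[symmetric] exp_add[symmetric])
  finally show ?thesis by (simp add: emeasure_eq_measure)
qed

text \<open>On the tail event \<open>defect\<close> is the conditional mean of
  \<open>1 - z\<^sup>2\<close>, so Jensen's inequality bounds its exponential moment by that of
  \<open>1 - z\<^sup>2\<close>, which is \<open>excess_mgf\<close> at threshold 0.\<close>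

lemma defect_mgf_central:
  assumes a: "0 \<le> a" and s: "0 \<le> s" "s \<le> 1/64"
  shows "(\<integral>\<^sup>+z. exp (s * defect a z) * std_normal_density z \<partial>lborel) \<le> exp (mgf_const * s\<^sup>2)"
proof -
  let ?e = "s * exp (s * (1 - nu a))"
  \<comment> \<open>Jensen's inequality through the tangent line of the exponential at
    \<open>z\<^sup>2 = nu a\<close>: the correction is a multiple of \<open>excess a z\<close> and
    integrates to 0.\<close>
  have pt: "exp (s * defect a z) \<le> exp (- s * excess 0 z) + ?e * excess a z" for z
  proof (cases "a \<le> \<bar>z\<bar>")
    case True
    have "exp (s * (1 - nu a)) * (1 + - s * (z\<^sup>2 - nu a)) \<le> exp (s * (1 - nu a)) * exp (- s * (z\<^sup>2 - nu a))"
      by (intro mult_left_mono exp_ge_add_one_self) auto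
    also have "\<dots> = exp (- s * (z\<^sup>2 - 1))" by (simp add: exp_add[symmetric] algebra_simps)
    finally show ?thesis using True by (simp add: defect_def excess_def nu_0 algebra_simps)
  qed (simp add: defect_def excess_def nu_0 algebra_simps)
  have "(\<integral>\<^sup>+z. exp (- s * excess 0 z) * std_normal_density z \<partial>lborel) \<le> exp (mgf_const * (-s)\<^sup>2 * exp (- 0\<^sup>2/4))"
    using s by (intro excess_mgf) auto
  then have N: "(\<integral>\<^sup>+z. exp (- s * excess 0 z) * std_normal_density z \<partial>lborel) \<le> exp (mgf_const * s\<^sup>2)" by simp
  have I1: "integrable lborel (\<lambda>z. exp (- s * excess 0 z) * std_normal_density z)"
    by (rule integrableI_bounded) (use N in \<open>auto simp: ennreal_less_top intro: le_less_trans\<close>)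
  have I2: "integrable lborel (\<lambda>z. ?e * (excess a z * std_normal_density z))"
    using excess_mean[of a] by (auto simp: has_bochner_integral_iff)
  have le: "exp (s * defect a z) * std_normal_density z
      \<le> exp (- s * excess 0 z) * std_normal_density z + ?e * (excess a z * std_normal_density z)" for z
    using mult_right_mono[OF pt[of z], of "std_normal_density z"] by (simp add: algebra_simps)
  have nn: "0 \<le> exp (- s * excess 0 z) * std_normal_density z + ?e * (excess a z * std_normal_density z)" for z
    by (rule order_trans[OF _ le]) simp
  have "(\<integral>\<^sup>+z. exp (s * defect a z) * std_normal_density z \<partial>lborel)
     \<le> (\<integral>\<^sup>+z. ennreal (exp (- s * excess 0 z) * std_normal_density z + ?e * (excess a z * std_normal_density z)) \<partial>lborel)"
    by (intro nn_integral_mono ennreal_leI le)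
  also have "\<dots> = ennreal (\<integral>z. exp (- s * excess 0 z) * std_normal_density z + ?e * (excess a z * std_normal_density z) \<partial>lborel)"
    using I1 I2 nn by (intro nn_integral_eq_integral) auto
  also have "(\<integral>z. exp (- s * excess 0 z) * std_normal_density z + ?e * (excess a z * std_normal_density z) \<partial>lborel)
      = (\<integral>z. exp (- s * excess 0 z) * std_normal_density z \<partial>lborel)"
    using I1 I2 excess_mean[of a] by (subst Bochner_Integration.integral_add) (auto simp: has_bochner_integral_iff)
  also have "ennreal \<dots> = (\<integral>\<^sup>+z. exp (- s * excess 0 z) * std_normal_density z \<partial>lborel)"
    using I1 by (intro nn_integral_eq_integral[symmetric]) auto
  finally show ?thesis using N by (rule order_trans)
qed

text \<open>Reflecting at \<open>m / 2\<close> changes the sign of \<open>std_normal_density x - std_normal_density (x - m)\<close>, and on the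
  side where this difference is positive the point is closer to \<open>0\<close> than its mirror image.\<close>

lemma std_normal_shift_antimono:
  fixes F :: "real \<Rightarrow> real"
  assumes [measurable]: "F \<in> borel_measurable borel" and F: "\<And>x y. \<bar>x\<bar> \<le> \<bar>y\<bar> \<Longrightarrow> F y \<le> F x"
    and nonneg: "\<And>x. 0 \<le> F x"
  shows "(\<integral>\<^sup>+z. F (m + z) * std_normal_density z \<partial>lborel) \<le> (\<integral>\<^sup>+z. F z * std_normal_density z \<partial>lborel)"
proof -
  let ?g = "std_normal_density"
  have ev: "?g (- x) = ?g x" for x by (simp add: normal_density_def)
  have bd: "F x \<le> F 0" for x by (rule F) simp
  have int: "integrable lborel (\<lambda>x. F (b + c * x) * ?g (d + c' * x))" if "c' \<noteq> 0" for b c d c'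
  proof (rule Bochner_Integration.integrable_bound)
    show "integrable lborel (\<lambda>x. F 0 * ?g (d + c' * x))"
      using lborel_integrable_real_affine[of "?g" c' d] that by auto
    show "AE x in lborel. norm (F (b + c * x) * ?g (d + c' * x)) \<le> norm (F 0 * ?g (d + c' * x))"
      using nonneg bd by (auto simp: abs_mult intro!: mult_right_mono)
  qed simp
  define D where "D x = ?g x - ?g (x - m)" for x
  have i1: "integrable lborel (\<lambda>x. F x * D x)"
    using int[of 1 0 1 0] int[of 1 0 1 "-m"] by (simp add: D_def algebra_simps)
  have i2: "integrable lborel (\<lambda>x. F (m - x) * D x)"
    using int[of 1 m "-1" 0] int[of 1 m "-1" "-m"] by (simp add: D_def algebra_simps)
  have refl: "D (m - x) = - D x" for x
    using ev[of x] ev[of "m - x"] by (simp add: D_def)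
  have "(\<integral>x. F (m - x) * D x \<partial>lborel) = - (\<integral>x. F x * D x \<partial>lborel)"
    using lborel_integral_real_affine[of "-1" "\<lambda>x. F x * D x" m] by (simp add: refl)
  \<comment> \<open>Averaging with the mirror image gives an integrand that is nonnegative
    pointwise.\<close>
  then have e: "(\<integral>x. (F x - F (m - x)) * D x \<partial>lborel) = 2 * (\<integral>x. F x * D x \<partial>lborel)"
    using i1 i2 by (simp add: left_diff_distrib)
  have mono: "?g x \<le> ?g y" if "\<bar>y\<bar> \<le> \<bar>x\<bar>" for x y
    using that power_mono[OF that, of 2] by (simp add: std_normal_density_def divide_right_mono)
  have "0 \<le> (F x - F (m - x)) * D x" for x
  proof (cases "\<bar>x\<bar> \<le> \<bar>m - x\<bar>")
    case True
    then have "0 \<le> D x" using mono[of x "x - m"] by (simp add: D_def abs_minus_commute)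
    then show ?thesis using F[OF True] by simp
  next
    case False
    then have "D x \<le> 0" using mono[of "x - m" x] by (simp add: D_def abs_minus_commute)
    then show ?thesis using F[of "m - x" x] False by (intro mult_nonpos_nonpos) auto
  qed
  then have "0 \<le> (\<integral>x. F x * D x \<partial>lborel)" using e by (metis (no_types, lifting) Bochner_Integration.integral_nonneg mult_2 add_nonneg_nonneg not_le add_neg_neg)
  moreover have "(\<integral>x. F x * D x \<partial>lborel) = (\<integral>x. F x * ?g x \<partial>lborel) - (\<integral>x. F x * ?g (x - m) \<partial>lborel)"
    using int[of 1 0 1 0] int[of 1 0 1 "-m"] by (simp add: D_def right_diff_distrib)
  moreover have "(\<integral>x. F x * ?g (x - m) \<partial>lborel) = (\<integral>z. F (m + z) * ?g z \<partial>lborel)"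
    using lborel_integral_real_affine[of 1 "\<lambda>x. F x * ?g (x - m)" m] by simp
  ultimately have "(\<integral>z. F (m + z) * ?g z \<partial>lborel) \<le> (\<integral>z. F z * ?g z \<partial>lborel)" by simp
  moreover have "(\<integral>\<^sup>+z. F (m + z) * ?g z \<partial>lborel) = (\<integral>z. F (m + z) * ?g z \<partial>lborel)"
    using int[of 1 m 1 0] nonneg by (intro nn_integral_eq_integral) auto
  moreover have "(\<integral>\<^sup>+z. F z * ?g z \<partial>lborel) = (\<integral>z. F z * ?g z \<partial>lborel)"
    using int[of 1 0 1 0] nonneg by (intro nn_integral_eq_integral) auto
  ultimately show ?thesis by (simp add: ennreal_leI)
qed

text \<open>Up to the threshold this is \<open>1 - z\<^sup>2\<close>, and the jump at the threshold
  goes down because \<open>a\<^sup>2 \<le> nu a\<close>.\<close>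

lemma defect_antimono: assumes "0 \<le> a" "\<bar>x\<bar> \<le> \<bar>y\<bar>" shows "defect a y \<le> defect a x"
proof -
  have "x\<^sup>2 \<le> y\<^sup>2" using power_mono[OF assms(2), of 2] by simp
  moreover have "x\<^sup>2 \<le> a\<^sup>2" if "\<not> a \<le> \<bar>x\<bar>" using that power_mono[of "\<bar>x\<bar>" a 2] by simp
  ultimately show ?thesis using assms nu_ge[of a] by (auto simp: defect_def)
qed

text \<open>Uniform in the shift \<open>m\<close>, which will be the unknown signal in one
  coordinate.\<close>

lemma defect_mgf:
  assumes a: "0 \<le> a" and s: "0 \<le> s" "s \<le> 1/64"
  shows "(\<integral>\<^sup>+z. exp (s * defect a (m + z)) * std_normal_density z \<partial>lborel) \<le> exp (mgf_const * s\<^sup>2)"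
proof -
  have "(\<integral>\<^sup>+z. exp (s * defect a (m + z)) * std_normal_density z \<partial>lborel)
     \<le> (\<integral>\<^sup>+z. exp (s * defect a z) * std_normal_density z \<partial>lborel)"
    by (rule std_normal_shift_antimono[of "\<lambda>x. exp (s * defect a x)"])
      (use defect_antimono[OF a] s in \<open>auto intro!: mult_left_mono\<close>)
  then show ?thesis using defect_mgf_central[OF assms] by (rule order_trans)
qed

text \<open>\<open>F\<close> may depend on the coordinate because the signal shifts do.\<close>

lemma (in prob_space) chernoff_normal:
  fixes Z :: "'i \<Rightarrow> 'a \<Rightarrow> real" and F :: "'i \<Rightarrow> real \<Rightarrow> real"
  assumes fin: "finite A" and ind: "indep_vars (\<lambda>_. borel) Z A"
    and dist: "\<And>i. i \<in> A \<Longrightarrow> distributed M lborel (Z i) std_normal_density"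
    and F [measurable]: "\<And>i. F i \<in> borel_measurable borel"
    and b: "\<And>i. i \<in> A \<Longrightarrow> (\<integral>\<^sup>+z. exp (F i z) * std_normal_density z \<partial>lborel) \<le> exp b"
  shows "prob {x \<in> space M. y \<le> (\<Sum>i\<in>A. F i (Z i x))} \<le> exp (real (card A) * b - y)"
proof (cases "A = {}")
  case True
  then show ?thesis using prob_space by (cases "y \<le> 0") auto
next
  case False
  have [measurable]: "Z i \<in> borel_measurable M" if "i \<in> A" for i using dist[OF that] distributed_measurable by fastforce
  have E1: "(\<integral>\<^sup>+x. ennreal (exp (F i (Z i x))) \<partial>M) \<le> exp b" if "i \<in> A" for i
  proof -
    have "(\<integral>\<^sup>+x. ennreal (exp (F i (Z i x))) \<partial>M) = (\<integral>\<^sup>+z. ennreal (std_normal_density z) * ennreal (exp (F i z)) \<partial>lborel)"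
      using distributed_nn_integral[OF dist[OF that], of "\<lambda>z. ennreal (exp (F i z))"] by simp
    also have "\<dots> = (\<integral>\<^sup>+z. exp (F i z) * std_normal_density z \<partial>lborel)"
      by (intro nn_integral_cong) (simp add: ennreal_mult'' mult.commute)
    finally show ?thesis using b[OF that] by simp
  qed
  have "(\<integral>\<^sup>+x. (\<Prod>i\<in>A. ennreal (exp (F i (Z i x)))) \<partial>M) = (\<Prod>i\<in>A. \<integral>\<^sup>+x. ennreal (exp (F i (Z i x))) \<partial>M)"
    by (rule indep_vars_nn_integral[OF fin indep_vars_compose2[OF ind]]) auto
  also have "\<dots> \<le> (\<Prod>i\<in>A. ennreal (exp b))" by (rule prod_mono_ennreal) (use E1 in auto)
  also have "\<dots> = ennreal (exp (real (card A) * b))" by (simp add: ennreal_power exp_of_nat_mult)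
  finally have E: "(\<integral>\<^sup>+x. ennreal (exp (\<Sum>i\<in>A. F i (Z i x))) \<partial>M) \<le> ennreal (exp (real (card A) * b))"
    using fin by (simp add: exp_sum prod_ennreal)
  show ?thesis by (rule exp_markov[OF _ E]) measurable
qed

section \<open>The noise matrix\<close>

lemma prob_space_noise: "0 < \<sigma> \<Longrightarrow> prob_space (noise_measure p n \<sigma>)"
  unfolding noise_measure_def by (intro prob_space_PiM prob_space_normal_density)

lemma noise_component_measurable [measurable]:
  "j \<in> {1..p} \<times> {1..n} \<Longrightarrow> (\<lambda>W. W j) \<in> borel_measurable (noise_measure p n \<sigma>)"
  using measurable_component_singleton[of j "{1..p} \<times> {1..n}" "\<lambda>_. density lborel (normal_density 0 \<sigma>)"]
  by (simp add: noise_measure_def)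

lemma noise_distr: assumes "0 < \<sigma>" "j \<in> {1..p} \<times> {1..n}"
  shows "distr (noise_measure p n \<sigma>) borel (\<lambda>W. W j) = density lborel (normal_density 0 \<sigma>)"
proof -
  have "distr (noise_measure p n \<sigma>) (density lborel (normal_density 0 \<sigma>)) (\<lambda>W. W j) = density lborel (normal_density 0 \<sigma>)"
    unfolding noise_measure_def
    by (rule distr_PiM_component) (use assms prob_space_normal_density in auto)
  then show ?thesis by (metis distr_cong sets_density sets_lborel)
qed

lemma noise_distributed: assumes "0 < \<sigma>" "j \<in> {1..p} \<times> {1..n}"
  shows "distributed (noise_measure p n \<sigma>) lborel (\<lambda>W. W j) (normal_density 0 \<sigma>)"
  using noise_distr[OF assms] assms noise_component_measurable[OF assms(2)]
  unfolding distributed_def by (auto cong: distr_cong simp: distr_cong[OF refl sets_lborel refl])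

text \<open>The joint law of the coordinates is the product measure itself, since its points are
  extensional functions, and the factors are the marginals. The empty index set is treated
  apart.\<close>

lemma noise_indep: assumes s: "0 < \<sigma>"
  shows "prob_space.indep_vars (noise_measure p n \<sigma>) (\<lambda>_. borel) (\<lambda>j W. W j) ({1..p} \<times> {1..n})"
proof -
  interpret prob_space "noise_measure p n \<sigma>" using s by (rule prob_space_noise)
  let ?I = "{1..p} \<times> {1..n}" let ?N = "noise_measure p n \<sigma>"
  show ?thesis
  proof (cases "?I = {}")
    case True
    show ?thesis unfolding True indep_vars_def indep_sets_def by auto
  next
    case False
    have e: "sets ?N = sets (PiM ?I (\<lambda>_. borel))"
      unfolding noise_measure_def by (rule sets_PiM_cong) auto
    have "distr ?N (PiM ?I (\<lambda>_. borel)) (\<lambda>W. \<lambda>j\<in>?I. W j) = distr ?N ?N (\<lambda>W. W)"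
    proof (rule distr_cong[OF refl])
      fix W assume "W \<in> space ?N"
      then show "(\<lambda>j\<in>?I. W j) = W" unfolding noise_measure_def space_PiM by (simp add: PiE_restrict)
    qed (simp add: e)
    also have "\<dots> = ?N" by simp
    also have "\<dots> = PiM ?I (\<lambda>j. distr ?N borel (\<lambda>W. W j))"
      using noise_distr[OF s] by (subst noise_measure_def, intro PiM_cong) auto
    finally show ?thesis using False
      by (subst indep_vars_iff_distr_eq_PiM') (auto intro!: noise_component_measurable)
  qed
qed

text \<open>Completing the square: the exponential tilt moves the mean to
  \<open>b * \<sigma>\<^sup>2\<close>.\<close>

lemma normal_mgf:
  assumes "0 < \<sigma>"
  shows "(\<integral>\<^sup>+z. ennreal (normal_density 0 \<sigma> z) * ennreal (exp (b * z)) \<partial>lborel) = exp (b\<^sup>2 * \<sigma>\<^sup>2 / 2)"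
proof -
  have e: "ennreal (normal_density 0 \<sigma> z) * ennreal (exp (b * z)) = exp (b\<^sup>2 * \<sigma>\<^sup>2 / 2) * ennreal (normal_density (b * \<sigma>\<^sup>2) \<sigma> z)" for z
  proof -
    have "- (z\<^sup>2 / (2 * \<sigma>\<^sup>2)) + b * z = b\<^sup>2 * \<sigma>\<^sup>2 / 2 - (z - b * \<sigma>\<^sup>2)\<^sup>2 / (2 * \<sigma>\<^sup>2)"
      using assms by (simp add: field_simps power2_eq_square)
    then have "exp (- (z\<^sup>2 / (2 * \<sigma>\<^sup>2))) * exp (b * z) = exp (b\<^sup>2 * \<sigma>\<^sup>2 / 2) * exp (- ((z - b * \<sigma>\<^sup>2)\<^sup>2 / (2 * \<sigma>\<^sup>2)))"
      by (simp add: exp_add[symmetric])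
    then show ?thesis by (simp add: normal_density_def ennreal_mult[symmetric])
  qed
  have "(\<integral>\<^sup>+z. ennreal (normal_density (b * \<sigma>\<^sup>2) \<sigma> z) \<partial>lborel) = 1"
    using assms by (subst nn_integral_eq_integral) auto
  then show ?thesis unfolding e by (simp add: nn_integral_cmult)
qed

text \<open>Chernoff bound with parameter 1; any other parameter can be put into the weights
  \<open>b\<close>.\<close>

lemma noise_linear_tail:
  assumes s: "0 < \<sigma>"
  shows "measure (noise_measure p n \<sigma>) {W \<in> space (noise_measure p n \<sigma>).
      y \<le> (\<Sum>j\<in>{1..p} \<times> {1..n}. b j * W j)} \<le> exp ((\<Sum>j\<in>{1..p} \<times> {1..n}. (b j)\<^sup>2) * \<sigma>\<^sup>2 / 2 - y)"
proof -
  interpret prob_space "noise_measure p n \<sigma>" using s by (rule prob_space_noise)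
  let ?I = "{1..p} \<times> {1..n}" let ?N = "noise_measure p n \<sigma>"
  have "(\<integral>\<^sup>+W. ennreal (exp (\<Sum>j\<in>?I. b j * W j)) \<partial>?N) = (\<integral>\<^sup>+W. (\<Prod>j\<in>?I. ennreal (exp (b j * W j))) \<partial>?N)"
    by (simp add: exp_sum prod_ennreal)
  also have "\<dots> = (\<Prod>j\<in>?I. \<integral>\<^sup>+W. ennreal (exp (b j * W j)) \<partial>?N)"
    by (rule indep_vars_nn_integral[OF _ indep_vars_compose2[OF noise_indep[OF s]]]) auto
  also have "\<dots> = (\<Prod>j\<in>?I. ennreal (exp ((b j)\<^sup>2 * \<sigma>\<^sup>2 / 2)))"
  proof (rule prod.cong[OF refl])
    fix j assume "j \<in> ?I"
    then show "(\<integral>\<^sup>+W. ennreal (exp (b j * W j)) \<partial>?N) = ennreal (exp ((b j)\<^sup>2 * \<sigma>\<^sup>2 / 2))"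
      using distributed_nn_integral[OF noise_distributed[OF s], of j p n "\<lambda>z. ennreal (exp (b j * z))"]
      by (simp add: normal_mgf[OF s])
  qed
  also have "\<dots> = ennreal (exp ((\<Sum>j\<in>?I. (b j)\<^sup>2) * \<sigma>\<^sup>2 / 2))"
    by (simp add: prod_ennreal exp_sum[symmetric] sum_distrib_right sum_divide_distrib)
  finally show ?thesis by (intro exp_markov) auto
qed

section \<open>The CUSUM as a linear functional of the noise\<close>

definition cusum_weight :: "nat \<Rightarrow> nat \<Rightarrow> nat \<Rightarrow> real" where
  "cusum_weight n v t = (if t \<le> v then sqrt ((real n - real v) / (real n * real v))
     else - sqrt (real v / (real n * (real n - real v))))"

lemma sum_split_at: "v \<le> n \<Longrightarrow> (\<Sum>t\<in>{1..n}. f t) = (\<Sum>t\<in>{1..v}. f t) + (\<Sum>t\<in>{v+1..n}. f t)"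
  for f :: "nat \<Rightarrow> real"
  using sum.ub_add_nat[of 1 v f "n - v"] by simp

lemma cusum_eq_weighted_sum:
  assumes "v < n" shows "cusum y 0 v n = (\<Sum>t\<in>{1..n}. cusum_weight n v t * y t)"
proof -
  have "(\<Sum>t\<in>{1..n}. cusum_weight n v t * y t) =
    (\<Sum>t\<in>{1..v}. cusum_weight n v t * y t) + (\<Sum>t\<in>{v+1..n}. cusum_weight n v t * y t)"
    using assms by (intro sum_split_at) simp
  also have "(\<Sum>t\<in>{1..v}. cusum_weight n v t * y t) = (\<Sum>t\<in>{1..v}. sqrt ((real n - real v) / (real n * real v)) * y t)"
    by (intro sum.cong) (auto simp: cusum_weight_def)
  also have "(\<Sum>t\<in>{v+1..n}. cusum_weight n v t * y t) = (\<Sum>t\<in>{v+1..n}. - sqrt (real v / (real n * (real n - real v))) * y t)"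
    by (intro sum.cong) (auto simp: cusum_weight_def)
  finally show ?thesis by (simp add: cusum_def sum_distrib_left sum_negf)
qed

lemma cusum_weight_norm: assumes "0 < v" "v < n" shows "(\<Sum>t\<in>{1..n}. (cusum_weight n v t)\<^sup>2) = 1"
proof -
  have "(\<Sum>t\<in>{1..n}. (cusum_weight n v t)\<^sup>2) =
    (\<Sum>t\<in>{1..v}. (cusum_weight n v t)\<^sup>2) + (\<Sum>t\<in>{v+1..n}. (cusum_weight n v t)\<^sup>2)"
    using assms by (intro sum_split_at) simp
  also have "(\<Sum>t\<in>{1..v}. (cusum_weight n v t)\<^sup>2) = (\<Sum>t\<in>{1..v}. (real n - real v) / (real n * real v))"
    using assms by (intro sum.cong) (auto simp: cusum_weight_def)
  also have "(\<Sum>t\<in>{v+1..n}. (cusum_weight n v t)\<^sup>2) = (\<Sum>t\<in>{v+1..n}. real v / (real n * (real n - real v)))"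
    using assms by (intro sum.cong) (auto simp: cusum_weight_def)
  finally show ?thesis using assms by (simp add: of_nat_diff field_simps)
qed

lemma cusum_noise_std_normal:
  assumes s: "0 < \<sigma>" and v: "0 < v" "v < n" and i: "i \<in> {1..p}"
  shows "distributed (noise_measure p n \<sigma>) lborel (\<lambda>W. cusum (\<lambda>t. W (i, t) / \<sigma>) 0 v n) std_normal_density"
proof -
  interpret prob_space "noise_measure p n \<sigma>" using s by (rule prob_space_noise)
  let ?N = "noise_measure p n \<sigma>"
  let ?X = "\<lambda>t W. cusum_weight n v t / \<sigma> * W (i, t)"
  \<comment> \<open>A zero weight would give a degenerate summand without a normal density.\<close>
  have w0: "cusum_weight n v t \<noteq> 0" for t using v by (auto simp: cusum_weight_def)
  have "indep_vars (\<lambda>t. PiM {(i, t)} (\<lambda>_. borel)) (\<lambda>t W. restrict (\<lambda>j. W j) {(i, t)}) {1..n}"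
    by (rule indep_vars_restrict[OF noise_indep[OF s]]) (use i in \<open>auto simp: disjoint_family_on_def\<close>)
  then have "indep_vars (\<lambda>_. borel) (\<lambda>t W. (\<lambda>U. cusum_weight n v t / \<sigma> * U (i, t)) (restrict (\<lambda>j. W j) {(i, t)})) {1..n}"
    by (rule indep_vars_compose2) (auto intro!: borel_measurable_times measurable_component_singleton)
  then have ind: "indep_vars (\<lambda>_. borel) ?X {1..n}" by simp
  have d: "distributed ?N lborel (?X t) (normal_density 0 \<bar>cusum_weight n v t\<bar>)" if "t \<in> {1..n}" for t
  proof -
    have "distributed ?N lborel (\<lambda>W. 0 + cusum_weight n v t / \<sigma> * W (i, t)) 
      (normal_density (0 + cusum_weight n v t / \<sigma> * 0) (\<bar>cusum_weight n v t / \<sigma>\<bar> * \<sigma>))"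
      using that i s w0 by (intro normal_density_affine noise_distributed) auto
    then show ?thesis using s by (simp add: abs_divide)
  qed
  have "distributed ?N lborel (\<lambda>W. \<Sum>t\<in>{1..n}. ?X t W) 
     (normal_density (\<Sum>t\<in>{1..n}. 0) (sqrt (\<Sum>t\<in>{1..n}. \<bar>cusum_weight n v t\<bar>\<^sup>2)))"
    by (rule sum_indep_normal[OF _ _ ind _ d]) (use w0 v in auto)
  then show ?thesis by (simp add: cusum_eq_weighted_sum[OF v(2)] cusum_weight_norm[OF v, simplified])
qed

text \<open>Different rows use disjoint blocks of the noise matrix.\<close>

lemma cusum_noise_indep:
  assumes s: "0 < \<sigma>" and v: "0 < v" "v < n"
  shows "prob_space.indep_vars (noise_measure p n \<sigma>) (\<lambda>_. borel) (\<lambda>i W. cusum (\<lambda>t. W (i, t) / \<sigma>) 0 v n) {1..p}"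
proof -
  interpret prob_space "noise_measure p n \<sigma>" using s by (rule prob_space_noise)
  have "indep_vars (\<lambda>i. PiM ({i} \<times> {1..n}) (\<lambda>_. borel)) (\<lambda>i W. restrict (\<lambda>j. W j) ({i} \<times> {1..n})) {1..p}"
    by (rule indep_vars_restrict[OF noise_indep[OF s]]) (auto simp: disjoint_family_on_def)
  then have "indep_vars (\<lambda>_. borel) (\<lambda>i W. (\<lambda>U. \<Sum>t\<in>{1..n}. cusum_weight n v t * (U (i, t) / \<sigma>)) (restrict (\<lambda>j. W j) ({i} \<times> {1..n}))) {1..p}"
    by (rule indep_vars_compose2) (auto intro!: borel_measurable_sum borel_measurable_times borel_measurable_divide measurable_component_singleton)
  then show ?thesis by (simp add: cusum_eq_weighted_sum[OF v(2)])
qed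

section \<open>The CUSUM of a single step\<close>

text \<open>\<open>A\<close> and \<open>- B\<close> are the two levels of the weight vector. The
  first relation says that it is orthogonal to constants.\<close>

lemma cusum_weight_relations:
  assumes "0 < v" "v < n"
  defines "A \<equiv> sqrt ((real n - real v) / (real n * real v))" and "B \<equiv> sqrt (real v / (real n * (real n - real v)))"
  shows "A * real v = B * (real n - real v)" "A * B = 1 / real n" "A\<^sup>2 = (real n - real v) / (real n * real v)"
    "B\<^sup>2 = real v / (real n * (real n - real v))" "A = B * (real n - real v) / real v"
proof -
  have p: "real n > 0" "real v > 0" "real n - real v > 0" using assms by auto
  show A2: "A\<^sup>2 = (real n - real v) / (real n * real v)" and B2: "B\<^sup>2 = real v / (real n * (real n - real v))"
    using p by (auto simp: A_def B_def)
  have AB: "0 \<le> A" "0 \<le> B" using p by (auto simp: A_def B_def)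
  show 1: "A * real v = B * (real n - real v)"
  proof (rule power2_eq_imp_eq)
    show "(A * real v)\<^sup>2 = (B * (real n - real v))\<^sup>2"
      using p by (simp add: power_mult_distrib A2 B2) (simp add: field_simps power2_eq_square)
  qed (use AB p in auto)
  show A: "A = B * (real n - real v) / real v" using 1 p by (simp add: field_simps)
  have "A * B = B\<^sup>2 * (real n - real v) / real v" by (subst A) (simp add: power2_eq_square)
  then show "A * B = 1 / real n" unfolding B2 using p by simp
qed

text \<open>The function \<open>c\<close> of the opening remarks: minus the CUSUM at
  \<open>v\<close> of a unit upward step after \<open>\<eta>\<close>, see
  \<open>cusum_step\<close>.\<close>

definition signal :: "nat \<Rightarrow> nat \<Rightarrow> nat \<Rightarrow> real" where
  "signal n \<eta> v = (if v \<le> \<eta> then (real n - real \<eta>) * sqrt (real v / (real n * (real n - real v)))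
     else real \<eta> * sqrt ((real n - real v) / (real n * real v)))"

text \<open>Since the weights annihilate constants, the level on the side of \<open>\<eta>\<close>
  containing \<open>v\<close> can be subtracted; the rest is the jump on the other side, where the
  weight is constant.\<close>

lemma cusum_step:
  assumes v: "0 < v" "v < n" and \<eta>: "0 < \<eta>" "\<eta> < n"
    and y: "\<And>t. t \<in> {1..n} \<Longrightarrow> y t = (if t \<le> \<eta> then y1 else y2)"
  shows "cusum y 0 v n = - signal n \<eta> v * (y2 - y1)"
proof -
  define A B where "A = sqrt ((real n - real v) / (real n * real v))" and "B = sqrt (real v / (real n * (real n - real v)))"
  note rel = cusum_weight_relations(1)[OF v, folded A_def B_def]
  have c: "cusum y 0 v n = A * (\<Sum>t\<in>{1..v}. y t) - B * (\<Sum>t\<in>{v+1..n}. y t)"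
    by (simp add: cusum_def A_def B_def)
  show ?thesis
  proof (cases "v \<le> \<eta>")
    case True
    have 1: "(\<Sum>t\<in>{1..v}. y t) = (\<Sum>t\<in>{1..v}. y1)" by (intro sum.cong) (use y True v in auto)
    have "(\<Sum>t\<in>{v+1..n}. y t) = (\<Sum>t\<in>{v+1..\<eta>}. y t) + (\<Sum>t\<in>{\<eta>+1..n}. y t)"
      using sum.ub_add_nat[of "v+1" \<eta> y "n - \<eta>"] True \<eta> by simp
    also have "(\<Sum>t\<in>{v+1..\<eta>}. y t) = (\<Sum>t\<in>{v+1..\<eta>}. y1)" by (intro sum.cong) (use y True \<eta> in auto)
    also have "(\<Sum>t\<in>{\<eta>+1..n}. y t) = (\<Sum>t\<in>{\<eta>+1..n}. y2)" by (intro sum.cong) (use y True v in auto)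
    finally have 2: "(\<Sum>t\<in>{v+1..n}. y t) = (real \<eta> - real v) * y1 + (real n - real \<eta>) * y2"
      using True \<eta> by (simp add: of_nat_diff)
    have "cusum y 0 v n = (A * real v) * y1 - B * ((real \<eta> - real v) * y1 + (real n - real \<eta>) * y2)"
      unfolding c 1 2 by simp
    also have "\<dots> = - ((real n - real \<eta>) * B) * (y2 - y1)" unfolding rel by (simp add: algebra_simps)
    finally show ?thesis using True by (simp add: signal_def B_def)
  next
    case False
    have 1: "(\<Sum>t\<in>{v+1..n}. y t) = (\<Sum>t\<in>{v+1..n}. y2)" by (intro sum.cong) (use y False v in auto)
    have "(\<Sum>t\<in>{1..v}. y t) = (\<Sum>t\<in>{1..\<eta>}. y t) + (\<Sum>t\<in>{\<eta>+1..v}. y t)"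
      using False by (intro sum_split_at) simp
    also have "(\<Sum>t\<in>{1..\<eta>}. y t) = (\<Sum>t\<in>{1..\<eta>}. y1)" by (intro sum.cong) (use y \<eta> in auto)
    also have "(\<Sum>t\<in>{\<eta>+1..v}. y t) = (\<Sum>t\<in>{\<eta>+1..v}. y2)" by (intro sum.cong) (use y v in auto)
    finally have 2: "(\<Sum>t\<in>{1..v}. y t) = real \<eta> * y1 + (real v - real \<eta>) * y2"
      using False by (simp add: of_nat_diff)
    have "cusum y 0 v n = A * (real \<eta> * y1 + (real v - real \<eta>) * y2) - (B * (real n - real v)) * y2"
      unfolding c 1 2 using v by (simp add: of_nat_diff)
    also have "\<dots> = - (real \<eta> * A) * (y2 - y1)" unfolding rel[symmetric] by (simp add: algebra_simps)
    finally show ?thesis using False by (simp add: signal_def A_def)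
  qed
qed

definition signal_gap :: "nat \<Rightarrow> nat \<Rightarrow> nat \<Rightarrow> real" where
  "signal_gap n \<eta> v = (signal n \<eta> \<eta>)\<^sup>2 - (signal n \<eta> v)\<^sup>2"

lemma signal_gap_eq:
  assumes v: "0 < v" "v < n" and \<eta>: "0 < \<eta>" "\<eta> < n"
  shows "signal_gap n \<eta> v = (if v \<le> \<eta> then (real n - real \<eta>) * (real \<eta> - real v) / (real n - real v)
      else real \<eta> * (real v - real \<eta>) / real v)"
proof -
  have p: "real n \<noteq> 0" "real v \<noteq> 0" "real n - real v \<noteq> 0" "real n - real \<eta> \<noteq> 0" using assms by auto
  show ?thesis
    using cusum_weight_relations(3,4)[OF v] cusum_weight_relations(4)[OF \<eta>] p
    by (simp add: signal_gap_def signal_def power_mult_distrib) (simp add: divide_simps; simp add: algebra_simps power2_eq_square)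
qed

text \<open>The gap has the form \<open>x * y / (x + y)\<close>, where \<open>y\<close> is the
  distance from \<open>v\<close> to \<open>\<eta>\<close> and \<open>x\<close> the distance from
  \<open>\<eta>\<close> to the end of the data on the other side; this is at least half the
  minimum.\<close>

lemma signal_gap_ge:
  assumes v: "0 < v" "v < n" and \<eta>: "0 < \<eta>" "\<eta> < n"
  shows "min \<bar>real v - real \<eta>\<bar> (real (min \<eta> (n - \<eta>))) / 2 \<le> signal_gap n \<eta> v"
proof -
  have har: "min x y / 2 \<le> x * y / (x + y)" if "0 < x" "0 \<le> y" for x y :: real
  proof (cases "x \<le> y")
    case True
    have "x * (x + y) \<le> x * (2 * y)" using that True by (intro mult_left_mono) auto
    then show ?thesis using that True by (simp add: field_simps)
  next
    case False
    have "y * (x + y) \<le> y * (2 * x)" using that False by (intro mult_left_mono) auto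
    then show ?thesis using that False by (simp add: field_simps)
  qed
  show ?thesis
  proof (cases "v \<le> \<eta>")
    case True
    have "min (real n - real \<eta>) (real \<eta> - real v) / 2 \<le> signal_gap n \<eta> v"
      using har[of "real n - real \<eta>" "real \<eta> - real v"] \<eta> True by (simp add: signal_gap_eq[OF assms])
    then show ?thesis using True \<eta> by (simp add: of_nat_diff)
  next
    case False
    have "min (real \<eta>) (real v - real \<eta>) / 2 \<le> signal_gap n \<eta> v"
      using har[of "real \<eta>" "real v - real \<eta>"] \<eta> False by (simp add: signal_gap_eq[OF assms])
    then show ?thesis using False \<eta> by (simp add: of_nat_diff)
  qed
qed

text \<open>The inner product of \<open>f\<close> with the unit vector \<open>\<psi> v\<close> is
  \<open>signal n \<eta> v\<close>. The subtracted vector is therefore the projection of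
  \<open>f\<close> onto \<open>\<psi> v\<close>, and the claim is Pythagoras.\<close>

lemma signal_contrast_norm:
  assumes v: "0 < v" "v < n" and \<eta>: "0 < \<eta>" "\<eta> < n"
  shows "(\<Sum>t\<in>{1..n}. (signal n \<eta> \<eta> * cusum_weight n \<eta> t - signal n \<eta> v * cusum_weight n v t)\<^sup>2) = signal_gap n \<eta> v"
proof -
  define \<psi> where "\<psi> w = cusum_weight n w" for w
  have sq: "(\<Sum>t\<in>{1..n}. (\<psi> w t)\<^sup>2) = 1" if "0 < w" "w < n" for w
    unfolding \<psi>_def using cusum_weight_norm[OF that] .
  \<comment> \<open>Up to a constant, \<open>- signal n \<eta> \<eta> * \<psi> \<eta>\<close> is the unit step at \<open>\<eta>\<close>, and CUSUM weights annihilate constants.\<close>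
  define f where "f t = signal n \<eta> \<eta> * \<psi> \<eta> t" for t
  have f: "f t = (if t \<le> \<eta> then (real n - real \<eta>) / real n else - (real \<eta> / real n))" for t
  proof -
    define A B where "A = sqrt ((real n - real \<eta>) / (real n * real \<eta>))" and "B = sqrt (real \<eta> / (real n * (real n - real \<eta>)))"
    note rel = cusum_weight_relations[OF \<eta>, folded A_def B_def]
    have "f t = (real n - real \<eta>) * (if t \<le> \<eta> then A * B else - B\<^sup>2)"
      by (simp add: f_def \<psi>_def cusum_weight_def signal_def power2_eq_square A_def B_def)
    then show ?thesis unfolding rel(2,4) using \<eta> by simp
  qed
  have inner: "(\<Sum>t\<in>{1..n}. \<psi> v t * f t) = signal n \<eta> v"
  proof -
    have "cusum f 0 v n = - signal n \<eta> v * (- (real \<eta> / real n) - (real n - real \<eta>) / real n)"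
      by (rule cusum_step[OF assms]) (simp add: f)
    also have "\<dots> = signal n \<eta> v" using \<eta> by (simp add: field_simps)
    finally show ?thesis using v by (simp add: cusum_eq_weighted_sum \<psi>_def)
  qed
  have "(\<Sum>t\<in>{1..n}. (f t - signal n \<eta> v * \<psi> v t)\<^sup>2)
    = (signal n \<eta> \<eta>)\<^sup>2 * (\<Sum>t\<in>{1..n}. (\<psi> \<eta> t)\<^sup>2) + (signal n \<eta> v)\<^sup>2 * (\<Sum>t\<in>{1..n}. (\<psi> v t)\<^sup>2)
      - 2 * signal n \<eta> v * (\<Sum>t\<in>{1..n}. \<psi> v t * f t)"
    unfolding sum_distrib_left sum.distrib[symmetric] sum_subtractf[symmetric]
    by (intro sum.cong) (auto simp: f_def power2_eq_square algebra_simps)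
  also have "\<dots> = signal_gap n \<eta> v"
    unfolding inner using sq v \<eta> by (simp add: signal_gap_def power2_eq_square)
  finally show ?thesis by (simp add: f_def \<psi>_def)
qed

section \<open>Tail bounds\<close>

definition noise_cusum :: "nat \<Rightarrow> real \<Rightarrow> nat \<Rightarrow> nat \<Rightarrow> (nat \<times> nat \<Rightarrow> real) \<Rightarrow> real" where
  "noise_cusum n \<sigma> v i W = cusum (\<lambda>t. W (i, t) / \<sigma>) 0 v n"

lemma noise_cusum_measurable [measurable]:
  assumes "i \<in> {1..p}" "v < n"
  shows "noise_cusum n \<sigma> v i \<in> borel_measurable (noise_measure p n \<sigma>)"
  unfolding noise_cusum_def cusum_eq_weighted_sum[OF assms(2)]
  by (intro borel_measurable_sum borel_measurable_times borel_measurable_divide noise_component_measurable)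
    (use assms in auto)

lemma noise_chernoff:
  assumes s: "0 < \<sigma>" and v: "0 < v" "v < n" and A: "A \<subseteq> {1..p}"
    and F: "\<And>i. F i \<in> borel_measurable borel"
    and b: "\<And>i. (\<integral>\<^sup>+z. exp (F i z) * std_normal_density z \<partial>lborel) \<le> exp b" and "0 \<le> b"
    and q: "real (card A) \<le> q"
  shows "measure (noise_measure p n \<sigma>) {W \<in> space (noise_measure p n \<sigma>). y \<le> (\<Sum>i\<in>A. F i (noise_cusum n \<sigma> v i W))}
     \<le> exp (q * b - y)"
proof -
  interpret prob_space "noise_measure p n \<sigma>" using s by (rule prob_space_noise)
  have fin: "finite A" using A finite_subset by blast
  have "prob {W \<in> space (noise_measure p n \<sigma>). y \<le> (\<Sum>i\<in>A. F i (noise_cusum n \<sigma> v i W))} \<le> exp (real (card A) * b - y)"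
    unfolding noise_cusum_def
    by (rule chernoff_normal[OF fin indep_vars_subset[OF cusum_noise_indep[OF s v] A] cusum_noise_std_normal[OF s v] F b])
      (use A in auto)
  also have "\<dots> \<le> exp (q * b - y)"
    using q \<open>0 \<le> b\<close> by (auto intro!: mult_right_mono)
  finally show ?thesis .
qed

text \<open>The Chernoff parameter \<open>r\<close> is left free because its choice depends on the
  sparsity regime; premise \<open>e\<close> says that the exponent is at most
  \<open>- x\<close>.\<close>

lemma excess_sum_tail:
  assumes s: "0 < \<sigma>" and v: "0 < v" "v < n" and A: "A \<subseteq> {1..p}" and a: "0 \<le> a" and r: "0 \<le> r" "r \<le> 1/64"
    and q: "real (card A) \<le> q"
    and e: "x \<le> r * y - mgf_const * r\<^sup>2 * (q * exp (- a\<^sup>2/4))"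
  shows "measure (noise_measure p n \<sigma>) {W \<in> space (noise_measure p n \<sigma>). y \<le> \<bar>\<Sum>i\<in>A. excess a (noise_cusum n \<sigma> v i W)\<bar>}
     \<le> 2 * exp (- x)"
proof -
  interpret prob_space "noise_measure p n \<sigma>" using s by (rule prob_space_noise)
  let ?N = "noise_measure p n \<sigma>" let ?b = "mgf_const * r\<^sup>2 * exp (- a\<^sup>2/4)"
  let ?E = "\<lambda>c. {W \<in> space ?N. r * y \<le> (\<Sum>i\<in>A. c * r * excess a (noise_cusum n \<sigma> v i W))}"
  have one: "prob (?E c) \<le> exp (- x)" if c: "c = 1 \<or> c = -1" for c :: real
  proof -
    have "prob (?E c) \<le> exp (q * ?b - r * y)"
    proof (rule noise_chernoff[OF s v A, where F="\<lambda>_ z. c * r * excess a z"])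
      fix i :: nat
      have "\<bar>c * r\<bar> \<le> 1/64" using c r by (auto simp: abs_mult)
      from excess_mgf[OF a this] show "(\<integral>\<^sup>+z. exp (c * r * excess a z) * std_normal_density z \<partial>lborel) \<le> exp ?b"
        using c by (auto simp: power_mult_distrib)
    qed (use q in auto)
    also have "\<dots> \<le> exp (- x)" using e by (simp add: mult_ac)
    finally show ?thesis .
  qed
  have m: "?E c \<in> sets ?N" for c
  proof -
    have "\<And>i. i \<in> A \<Longrightarrow> noise_cusum n \<sigma> v i \<in> borel_measurable ?N" using A v by (auto intro: noise_cusum_measurable)
    note [measurable] = this
    show ?thesis by measurable
  qed
  have "{W \<in> space ?N. y \<le> \<bar>\<Sum>i\<in>A. excess a (noise_cusum n \<sigma> v i W)\<bar>} \<subseteq> ?E 1 \<union> ?E (-1)"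
  proof
    fix W assume W: "W \<in> {W \<in> space ?N. y \<le> \<bar>\<Sum>i\<in>A. excess a (noise_cusum n \<sigma> v i W)\<bar>}"
    let ?S = "\<Sum>i\<in>A. excess a (noise_cusum n \<sigma> v i W)"
    have "y \<le> ?S \<or> y \<le> - ?S" using W by auto
    then have "r * y \<le> r * ?S \<or> r * y \<le> r * - ?S"
      using mult_left_mono[OF _ r(1), of y ?S] mult_left_mono[OF _ r(1), of y "- ?S"] by blast
    then show "W \<in> ?E 1 \<union> ?E (-1)" using W by (auto simp: sum_distrib_left sum_negf)
  qed
  then have "prob {W \<in> space ?N. y \<le> \<bar>\<Sum>i\<in>A. excess a (noise_cusum n \<sigma> v i W)\<bar>} \<le> prob (?E 1 \<union> ?E (-1))"
    by (rule finite_measure_mono) (intro sets.Un m)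
  also have "\<dots> \<le> prob (?E 1) + prob (?E (-1))" by (rule measure_Un_le; rule m)
  finally show ?thesis using one[of 1] one[of "-1"] by simp
qed

text \<open>One-sided: the comparison with the unshifted case controls upward deviations, uniformly
  in the shifts \<open>m\<close>.\<close>

lemma defect_sum_tail:
  assumes s: "0 < \<sigma>" and v: "0 < v" "v < n" and a: "0 \<le> a" and r: "0 \<le> r" "r \<le> 1/64"
    and e: "x \<le> r * y - mgf_const * r\<^sup>2 * real p"
  shows "measure (noise_measure p n \<sigma>) {W \<in> space (noise_measure p n \<sigma>). y \<le> (\<Sum>i\<in>{1..p}. defect a (m i + noise_cusum n \<sigma> v i W))}
     \<le> exp (- x)"
proof -
  interpret prob_space "noise_measure p n \<sigma>" using s by (rule prob_space_noise)
  let ?N = "noise_measure p n \<sigma>"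
  have "{W \<in> space ?N. y \<le> (\<Sum>i\<in>{1..p}. defect a (m i + noise_cusum n \<sigma> v i W))}
     \<subseteq> {W \<in> space ?N. r * y \<le> (\<Sum>i\<in>{1..p}. r * defect a (m i + noise_cusum n \<sigma> v i W))}"
    using r by (auto simp: sum_distrib_left[symmetric] intro: mult_left_mono)
  moreover have "{W \<in> space ?N. r * y \<le> (\<Sum>i\<in>{1..p}. r * defect a (m i + noise_cusum n \<sigma> v i W))} \<in> sets ?N"
  proof -
    have "\<And>i. i \<in> {1..p} \<Longrightarrow> noise_cusum n \<sigma> v i \<in> borel_measurable ?N" using v by (auto intro: noise_cusum_measurable)
    note [measurable] = this
    show ?thesis by measurable
  qed
  ultimately have "prob {W \<in> space ?N. y \<le> (\<Sum>i\<in>{1..p}. defect a (m i + noise_cusum n \<sigma> v i W))}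
     \<le> prob {W \<in> space ?N. r * y \<le> (\<Sum>i\<in>{1..p}. r * defect a (m i + noise_cusum n \<sigma> v i W))}"
    by (rule finite_measure_mono)
  also have "\<dots> \<le> exp (real p * (mgf_const * r\<^sup>2) - r * y)"
    by (rule noise_chernoff[OF s v, where F="\<lambda>i z. r * defect a (m i + z)"]) (use defect_mgf[OF a r] in auto)
  also have "\<dots> \<le> exp (- x)" using e by (simp add: mult_ac)
  finally show ?thesis .
qed

text \<open>By \<open>signal_contrast_norm\<close> the variance of the linear form is the signal
  loss itself, so its fluctuation is paid for by half of that loss plus a multiple of
  \<open>x\<close>.\<close>

lemma signal_noise_tail:
  assumes s: "0 < \<sigma>" and v: "0 < v" "v < n" and \<eta>: "0 < \<eta>" "\<eta> < n"
  shows "measure (noise_measure p n \<sigma>) {W \<in> space (noise_measure p n \<sigma>).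
     (\<Sum>i\<in>{1..p}. (th i)\<^sup>2) * signal_gap n \<eta> v / 2 + 4 * x
      \<le> 2 * (\<Sum>i\<in>{1..p}. th i * (signal n \<eta> \<eta> * noise_cusum n \<sigma> \<eta> i W - signal n \<eta> v * noise_cusum n \<sigma> v i W))} \<le> exp (- x)"
proof -
  define b where "b t = signal n \<eta> \<eta> * cusum_weight n \<eta> t - signal n \<eta> v * cusum_weight n v t" for t
  define D where "D = (\<Sum>i\<in>{1..p}. (th i)\<^sup>2) * signal_gap n \<eta> v"
  \<comment> \<open>With the factor 4 outside, the inner sum has variance \<open>D/4\<close>. Its
    Chernoff cost \<open>D/8\<close> becomes \<open>D/2\<close> after multiplication by 4.\<close>
  have e: "2 * (\<Sum>i\<in>{1..p}. th i * (signal n \<eta> \<eta> * noise_cusum n \<sigma> \<eta> i W - signal n \<eta> v * noise_cusum n \<sigma> v i W))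
     = 4 * (\<Sum>j\<in>{1..p} \<times> {1..n}. (th (fst j) * b (snd j) / (2 * \<sigma>)) * W j)" for W
  proof -
    have "signal n \<eta> \<eta> * noise_cusum n \<sigma> \<eta> i W - signal n \<eta> v * noise_cusum n \<sigma> v i W = (\<Sum>t\<in>{1..n}. b t * (W (i, t) / \<sigma>))" for i
      unfolding noise_cusum_def cusum_eq_weighted_sum[OF v(2)] cusum_eq_weighted_sum[OF \<eta>(2)] sum_distrib_left sum_subtractf[symmetric]
      by (intro sum.cong) (auto simp: b_def algebra_simps)
    moreover have "(\<Sum>j\<in>{1..p} \<times> {1..n}. (th (fst j) * b (snd j) / (2 * \<sigma>)) * W j)
      = (\<Sum>i\<in>{1..p}. \<Sum>t\<in>{1..n}. (th i * b t / (2 * \<sigma>)) * W (i, t))"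
      by (simp add: sum.cartesian_product case_prod_unfold)
    ultimately show ?thesis by (simp add: sum_distrib_left mult_ac)
  qed
  have "(\<Sum>j\<in>{1..p} \<times> {1..n}. (th (fst j) * b (snd j) / (2 * \<sigma>))\<^sup>2) = (\<Sum>i\<in>{1..p}. \<Sum>t\<in>{1..n}. (th i)\<^sup>2 * (b t)\<^sup>2 / (4 * \<sigma>\<^sup>2))"
    by (simp add: sum.cartesian_product case_prod_unfold power_mult_distrib power_divide)
  also have "\<dots> = (\<Sum>i\<in>{1..p}. (th i)\<^sup>2) * (\<Sum>t\<in>{1..n}. (b t)\<^sup>2) / (4 * \<sigma>\<^sup>2)"
    by (simp add: sum_product sum_divide_distrib)
  also have "(\<Sum>t\<in>{1..n}. (b t)\<^sup>2) = signal_gap n \<eta> v"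
    unfolding b_def by (rule signal_contrast_norm[OF v \<eta>])
  finally have ex: "(\<Sum>j\<in>{1..p} \<times> {1..n}. (th (fst j) * b (snd j) / (2 * \<sigma>))\<^sup>2) * \<sigma>\<^sup>2 / 2 - (D/8 + x) = - x"
    using s by (simp add: D_def)
  have "measure (noise_measure p n \<sigma>) {W \<in> space (noise_measure p n \<sigma>).
      D/8 + x \<le> (\<Sum>j\<in>{1..p} \<times> {1..n}. (th (fst j) * b (snd j) / (2 * \<sigma>)) * W j)} \<le> exp (- x)"
    using noise_linear_tail[OF s, where p=p and n=n and y="D/8 + x" and b="\<lambda>j. th (fst j) * b (snd j) / (2 * \<sigma>)"]
    unfolding ex .
  moreover have "(D/2 + 4 * x \<le> 4 * X) = (D/8 + x \<le> X)" for X :: real by auto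
  ultimately show ?thesis unfolding e D_def[symmetric] by simp
qed

section \<open>Levels of the threshold and the penalty\<close>

definition lev :: "nat \<Rightarrow> nat \<Rightarrow> real \<Rightarrow> real" where
  "lev p n t = ln (exp 1 * real p * ln (real n) / t\<^sup>2)"

lemma ln_ge_half: assumes "2 \<le> n" shows "1/2 \<le> ln (real n)"
proof -
  have "exp (1/2::real) \<le> 2" using exp_bound[of "1/2::real"] by (simp add: power2_eq_square)
  then have "exp (1/2) \<le> real n" using assms by linarith
  then show ?thesis using assms by (subst ln_ge_iff) auto
qed

lemma lev_eq:
  assumes "2 \<le> n" "1 \<le> p" "0 < t" shows "lev p n t = 1 + ln (real p * ln (real n) / t\<^sup>2)"
proof -
  have "0 < real p * ln (real n) / t\<^sup>2" using assms ln_ge_half[of n] by simp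
  then have "ln (exp 1 * (real p * ln (real n) / t\<^sup>2)) = 1 + ln (real p * ln (real n) / t\<^sup>2)"
    using assms by (subst ln_mult) auto
  then show ?thesis by (simp add: lev_def mult.assoc)
qed

text \<open>The factor 4 in the squared threshold makes
  \<open>exp (- (thr p n t)\<^sup>2 / 4)\<close> equal to
  \<open>t\<^sup>2 / (exp 1 * p * ln n)\<close>, so the variance proxy of all \<open>p\<close> rows
  together is of order \<open>t\<^sup>2 / ln n\<close>.\<close>

lemma sparse_level:
  assumes n: "2 \<le> n" and p: "1 \<le> p" and t: "0 < t" "t \<le> sqrt (real p * ln (real n))"
  shows lev_ge_1: "1 \<le> lev p n t"
    and thr_sq: "(thr p n t)\<^sup>2 = 4 * lev p n t"
    and exp_thr: "real p * exp (- (thr p n t)\<^sup>2 / 4) \<le> t\<^sup>2 / ln (real n)"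
    and rfun_ge: "t * lev p n t \<le> rfun p n t"
    and rfun_le: "rfun p n t \<le> t * lev p n t + ln (real n)"
proof -
  have L: "0 < ln (real n)" using ln_ge_half[OF n] by linarith
  have pL: "0 < real p * ln (real n)" using p L by simp
  have t2: "t\<^sup>2 \<le> real p * ln (real n)" using t pL by (metis less_le_not_le linorder_le_cases order.trans real_le_rsqrt real_sqrt_le_iff real_sqrt_pow2 power_mono)
  then have "1 \<le> real p * ln (real n) / t\<^sup>2" using t by simp
  then show 1: "1 \<le> lev p n t" by (simp add: lev_eq[OF n p t(1)])
  show 2: "(thr p n t)\<^sup>2 = 4 * lev p n t" using 1 t(2) by (simp add: thr_def lev_def)
  have "exp (- lev p n t) = t\<^sup>2 / (exp 1 * real p * ln (real n))"
    unfolding lev_def using pL t by (simp add: exp_minus mult.assoc)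
  then have "real p * exp (- (thr p n t)\<^sup>2 / 4) = t\<^sup>2 / (exp 1 * ln (real n))" using 2 p by simp
  also have "\<dots> \<le> t\<^sup>2 / ln (real n)" using L exp_ge_add_one_self[of "1::real"] by (intro divide_left_mono) auto
  finally show "real p * exp (- (thr p n t)\<^sup>2 / 4) \<le> t\<^sup>2 / ln (real n)" .
  \<comment> \<open>At this endpoint \<open>rfun\<close> already takes its dense branch, whose value
    agrees with \<open>t * lev p n t\<close> because the logarithm is 1.\<close>
  have eq: "lev p n t = 1" if "t = sqrt (real p * ln (real n))"
  proof -
    have "t\<^sup>2 = real p * ln (real n)" using that pL by simp
    then show ?thesis using pL by (simp add: lev_eq[OF n p t(1)])
  qed
  show "t * lev p n t \<le> rfun p n t" using eq t by (auto simp: rfun_def lev_def[symmetric])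
  show "rfun p n t \<le> t * lev p n t + ln (real n)"
    using eq t L 1 by (auto simp: rfun_def lev_def[symmetric])
qed

lemma thr_nonneg: assumes "2 \<le> n" "1 \<le> p" "0 < t" shows "0 \<le> thr p n t"
  using lev_ge_1[OF assms] by (auto simp: thr_def lev_def[symmetric])

lemma thr_dense: "sqrt (real p * ln (real n)) < t \<Longrightarrow> thr p n t = 0"
  by (simp add: thr_def)

lemma rfun_nonneg: assumes "2 \<le> n" shows "0 \<le> rfun p n t"
  using ln_ge_half[OF assms] by (auto simp: rfun_def intro: order_trans[of _ "ln (real n)"])

text \<open>The Chernoff parameter is \<open>1/64\<close> for \<open>t \<le> ln n\<close> and \<open>ln n / (64 * t)\<close> beyond. The summand \<open>ln n\<close> in the
  threshold is redundant unless \<open>t\<close> equals \<open>sqrt (p * ln n)\<close> and \<open>p < ln n\<close>, where \<open>rfun\<close> is smaller than \<open>ln n\<close>.\<close>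

lemma sparse_excess_tail:
  assumes s: "0 < \<sigma>" and v: "0 < v" "v < n" and p: "1 \<le> p" and A: "A \<subseteq> {1..p}"
    and t: "0 < t" "t \<le> sqrt (real p * ln (real n))"
  shows "measure (noise_measure p n \<sigma>) {W \<in> space (noise_measure p n \<sigma>).
       1408 * (rfun p n t + ln (real n)) \<le> \<bar>\<Sum>i\<in>A. excess (thr p n t) (noise_cusum n \<sigma> v i W)\<bar>}
     \<le> 2 * (exp (- 12 * (ln (real n) + t)) + exp (- 12 * (lev p n t * ln (real n))))"
proof -
  define L l where "L = ln (real n)" and "l = lev p n t"
  have n: "2 \<le> n" using v by simp
  have L: "1/2 \<le> L" using ln_ge_half[OF n] by (simp add: L_def)
  note sl = sparse_level[OF n p t, folded L_def l_def]
  let ?V = "real p * exp (- (thr p n t)\<^sup>2 / 4)" let ?y = "1408 * (rfun p n t + L)"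
  let ?P = "measure (noise_measure p n \<sigma>) {W \<in> space (noise_measure p n \<sigma>). ?y \<le> \<bar>\<Sum>i\<in>A. excess (thr p n t) (noise_cusum n \<sigma> v i W)\<bar>}"
  have y: "1408 * (t * l + L) \<le> ?y" using sl(4) by simp
  have tl: "t \<le> t * l" using sl(1) t by simp
  have q: "real (card A) \<le> real p" using card_mono[OF _ A] by simp
  note tail = excess_sum_tail[OF s v A thr_nonneg[OF n p t(1)] _ _ q]
  have "?P \<le> 2 * exp (- 12 * (L + t)) \<or> ?P \<le> 2 * exp (- 12 * (l * L))"
  proof (cases "t \<le> L")
    case True
    have "t\<^sup>2 / L \<le> t" using True t L by (simp add: field_simps power2_eq_square)
    then have V: "?V \<le> t" using sl(3) by linarith
    \<comment> \<open>Here \<open>1408 / 64 = 22\<close>, and \<open>mgf_const / 64\<^sup>2\<close>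
      is below 10; the difference leaves the exponent 12.\<close>
    have "12 * (L + t) \<le> 1/64 * ?y - mgf_const * (1/64)\<^sup>2 * ?V"
    proof -
      have "12 * (L + t) \<le> 22 * (t + L) - 10 * t" using L by simp
      also have "\<dots> \<le> 1/64 * ?y - mgf_const * (1/64)\<^sup>2 * ?V"
      proof (rule diff_mono)
        show "22 * (t + L) \<le> 1/64 * ?y" using y tl by simp
        show "mgf_const * (1/64)\<^sup>2 * ?V \<le> 10 * t" using V t by (simp add: power2_eq_square)
      qed
      finally show ?thesis .
    qed
    from tail[OF _ _ this] show ?thesis by simp
  next
    case False
    define r where "r = L / (64 * t)"
    have r: "0 \<le> r" "r \<le> 1/64" using False t L by (auto simp: r_def field_simps)
    have "12 * (l * L) \<le> r * ?y - mgf_const * r\<^sup>2 * ?V"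
    proof -
      have "r * ?y \<ge> r * (1408 * (t * l))" using y r L by (intro mult_left_mono) auto
      moreover have "r * (1408 * (t * l)) = 22 * (l * L)" using t by (simp add: r_def)
      moreover have "mgf_const * r\<^sup>2 * ?V \<le> mgf_const * r\<^sup>2 * (t\<^sup>2 / L)" using sl(3) by (intro mult_left_mono) auto
      moreover have "mgf_const * r\<^sup>2 * (t\<^sup>2 / L) = mgf_const / 4096 * L"
        using t L by (simp add: r_def field_simps power2_eq_square)
      moreover have "L \<le> l * L" using sl(1) L by simp
      ultimately show ?thesis using L by linarith
    qed
    from tail[OF r this] show ?thesis by simp
  qed
  then show ?thesis unfolding L_def[symmetric] l_def[symmetric]
    by (smt (verit) exp_ge_zero)
qed

text \<open>Without thresholding the variance proxy is of order \<open>p\<close>, and the Chernoff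
  parameter of order \<open>sqrt (ln n / p)\<close> is admissible because
  \<open>ln n \<le> p\<close>.\<close>

lemma dense_excess_tail:
  assumes s: "0 < \<sigma>" and v: "0 < v" "v < n" and A: "A \<subseteq> {1..p}" and p: "ln (real n) \<le> real p"
  shows "measure (noise_measure p n \<sigma>) {W \<in> space (noise_measure p n \<sigma>).
       1408 * sqrt (real p * ln (real n)) \<le> \<bar>\<Sum>i\<in>A. excess 0 (noise_cusum n \<sigma> v i W)\<bar>} \<le> 2 * exp (- (12 * ln (real n)))"
proof -
  define L where "L = ln (real n)"
  have L: "1/2 \<le> L" using ln_ge_half[of n] v by (simp add: L_def)
  define r where "r = sqrt (L / p) / 64"
  have p0: "0 < real p" using p L unfolding L_def by linarith
  have "sqrt (L / p) \<le> 1" using p p0 by (simp add: L_def)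
  then have r: "0 \<le> r" "r \<le> 1/64" using L by (auto simp: r_def)
  have "r * (1408 * sqrt (real p * L)) = 22 * sqrt (L / p * (p * L))"
    unfolding real_sqrt_mult[of "L/p"] by (simp add: r_def)
  also have "L / p * (p * L) = L\<^sup>2" using p0 by (simp add: power2_eq_square)
  finally have "r * (1408 * sqrt (real p * L)) = 22 * L" using L by simp
  moreover have "r\<^sup>2 * real p = L / 4096" using L p0 by (simp add: r_def power_divide)
  ultimately have "12 * L \<le> r * (1408 * sqrt (real p * L)) - mgf_const * r\<^sup>2 * (real p * exp (- 0\<^sup>2/4))"
    using L by (simp add: mult.assoc)
  from excess_sum_tail[OF s v A order_refl r _ this] card_mono[OF _ A] show ?thesis by (simp add: L_def)
qed

text \<open>Applied with the maximum of \<open>ln n\<close> and \<open>ln (ln (exp 1 * p))\<close>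
  as \<open>M\<close>, for which \<open>sqrt (p * M)\<close> is the dense branch of
  \<open>hfun\<close>.\<close>

lemma dense_defect_tail:
  assumes s: "0 < \<sigma>" and v: "0 < v" "v < n" and a: "0 \<le> a" and M: "0 < M" "M \<le> real p"
  shows "measure (noise_measure p n \<sigma>) {W \<in> space (noise_measure p n \<sigma>).
       1408 * sqrt (real p * M) \<le> (\<Sum>i\<in>{1..p}. defect a (m i + noise_cusum n \<sigma> v i W))} \<le> exp (- (12 * M))"
proof -
  define r where "r = sqrt (M / p) / 64"
  have p0: "0 < real p" using M by linarith
  have "sqrt (M / p) \<le> 1" using M p0 by simp
  then have r: "0 \<le> r" "r \<le> 1/64" using M by (auto simp: r_def)
  have "r * (1408 * sqrt (real p * M)) = 22 * sqrt (M / p * (p * M))"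
    unfolding real_sqrt_mult[of "M/p"] by (simp add: r_def)
  also have "M / p * (p * M) = M\<^sup>2" using p0 by (simp add: power2_eq_square)
  finally have "r * (1408 * sqrt (real p * M)) = 22 * M" using M by simp
  moreover have "r\<^sup>2 * real p = M / 4096" using M p0 by (simp add: r_def power_divide)
  ultimately have "12 * M \<le> r * (1408 * sqrt (real p * M)) - mgf_const * r\<^sup>2 * real p"
    using M by (simp add: mult.assoc)
  from defect_sum_tail[OF s v a r this] show ?thesis .
qed

text \<open>Used on the support of the change, where a deviation of order \<open>k + ln n\<close> is
  affordable in the sparse regime.\<close>

lemma excess_0_tail:
  assumes s: "0 < \<sigma>" and v: "0 < v" "v < n" and A: "A \<subseteq> {1..p}"
  shows "measure (noise_measure p n \<sigma>) {W \<in> space (noise_measure p n \<sigma>).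
       1409 * (real (card A) + ln (real n)) \<le> \<bar>\<Sum>i\<in>A. excess 0 (noise_cusum n \<sigma> v i W)\<bar>} \<le> 2 * exp (- (12 * ln (real n)))"
proof (rule excess_sum_tail[OF s v A order_refl _ _ order_refl])
  show "12 * ln (real n) \<le> 1/64 * (1409 * (real (card A) + ln (real n))) - mgf_const * (1/64)\<^sup>2 * (real (card A) * exp (- 0\<^sup>2/4))"
    using ln_ge_half[of n] v of_nat_0_le_iff[of "card A"] by (simp add: power2_eq_square field_simps)
qed auto

lemma excess_0: "excess 0 z = z\<^sup>2 - 1"
  by (simp add: excess_def nu_0)

section \<open>Candidate sparsities and scores\<close>

lemma cand_finite: "finite (cand p n)"
proof -
  have "{2 ^ m | m. real (2 ^ m) \<le> real_of_int \<lfloor>sqrt (real p * ln (real n))\<rfloor>} \<subseteq> {..nat \<lfloor>sqrt (real p * ln (real n))\<rfloor>}"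
    by (auto simp: le_nat_iff)
  then show ?thesis unfolding cand_def by (simp add: finite_subset)
qed

lemma p_in_cand: "p \<in> cand p n" by (simp add: cand_def)

lemma cand_pos: "1 \<le> p \<Longrightarrow> t \<in> cand p n \<Longrightarrow> 1 \<le> t" by (auto simp: cand_def)

text \<open>In the dense branch \<open>sqrt (p * ln n) \<le> k \<le> p\<close> forces
  \<open>ln n \<le> p\<close>.\<close>

lemma hfun_ge_ln:
  assumes n: "2 \<le> n" and k: "1 \<le> k" "k \<le> p" shows "ln (real n) \<le> hfun p n (real k)"
proof (cases "sqrt (real p * ln (real n)) \<le> real k")
  case True
  define L where "L = ln (real n)"
  have L: "1/2 \<le> L" using ln_ge_half[OF n] by (simp add: L_def)
  have "sqrt (real p * L) \<le> real p" using True k by (simp add: L_def)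
  then have "real p * L \<le> (real p)\<^sup>2" by (rule sqrt_le_D)
  then have "L \<le> real p" using k by (simp add: power2_eq_square)
  then have "L\<^sup>2 \<le> real p * max L (ln (ln (exp 1 * real p)))" unfolding power2_eq_square using L by (intro mult_mono) auto
  then have "L \<le> sqrt (real p * max L (ln (ln (exp 1 * real p))))" by (rule real_le_rsqrt)
  then show ?thesis using True by (simp add: hfun_def L_def)
qed (simp add: hfun_def)

lemma hfun_ge_lev:
  assumes n: "2 \<le> n" and p: "1 \<le> p" and k: "1 \<le> k" "real k \<le> sqrt (real p * ln (real n))"
  shows "real k * lev p n (real k) \<le> hfun p n (real k)"
proof (cases "sqrt (real p * ln (real n)) \<le> real k")
  case True
  have L: "0 < ln (real n)" using ln_ge_half[OF n] by linarith
  have eq: "real k = sqrt (real p * ln (real n))" using True k by simp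
  have "lev p n (real k) = 1"
  proof -
    have "(real k)\<^sup>2 = real p * ln (real n)" using eq L by simp
    then show ?thesis using L p k by (simp add: lev_eq[OF n p])
  qed
  moreover have "sqrt (real p * ln (real n)) \<le> hfun p n (real k)"
    using True p by (simp add: hfun_def mult_left_mono)
  ultimately show ?thesis using eq by simp
qed (simp add: hfun_def lev_def)

text \<open>Rounding \<open>k\<close> down to a power of two at most quadruples the argument of the
  logarithm. This adds \<open>ln 4 \<le> 2\<close>, which is at most twice
  \<open>lev p n k\<close>.\<close>

lemma dyadic_candidate:
  assumes n: "2 \<le> n" and p: "1 \<le> p" and k: "1 \<le> k" "real k \<le> sqrt (real p * ln (real n))"
  obtains t where "t \<in> cand p n" "1 \<le> t" "t \<le> k" "lev p n (real t) \<le> 3 * lev p n (real k)"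
proof -
  obtain m where m: "2 ^ m \<le> k" "k < 2 ^ (m + 1)" using ex_power_ivl1[of 2 k] k by auto
  let ?t = "2 ^ m :: nat"
  have "real ?t \<le> sqrt (real p * ln (real n))" using m k by (meson of_nat_mono order_trans)
  then have "int ?t \<le> \<lfloor>sqrt (real p * ln (real n))\<rfloor>" by (simp add: le_floor_iff)
  then have "real_of_int (int ?t) \<le> real_of_int \<lfloor>sqrt (real p * ln (real n))\<rfloor>" by (simp only: of_int_le_iff)
  then have c: "?t \<in> cand p n" unfolding cand_def by (intro UnI1 CollectI exI[of _ m]) simp
  have L: "0 < ln (real n)" using ln_ge_half[OF n] by linarith
  have pL: "0 < real p * ln (real n)" using p L by simp
  have "real k \<le> real (2 ^ (m + 1))" using m(2) by (intro of_nat_mono) simp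
  then have "(real k)\<^sup>2 \<le> (2 * real ?t)\<^sup>2" by (intro power_mono) auto
  then have k2: "(real k)\<^sup>2 \<le> 4 * (real ?t)\<^sup>2" by (simp add: power_mult_distrib)
  have "real p * ln (real n) / (real ?t)\<^sup>2 \<le> 4 * (real p * ln (real n) / (real k)\<^sup>2)"
  proof -
    have "real p * ln (real n) * (real k)\<^sup>2 \<le> real p * ln (real n) * (4 * (real ?t)\<^sup>2)"
      using k2 pL by (intro mult_left_mono) auto
    then show ?thesis using k by (simp add: divide_simps mult_ac)
  qed
  then have "ln (real p * ln (real n) / (real ?t)\<^sup>2) \<le> ln (4 * (real p * ln (real n) / (real k)\<^sup>2))"
    using pL k by (subst ln_le_cancel_iff) auto
  also have "\<dots> = ln 4 + ln (real p * ln (real n) / (real k)\<^sup>2)" using p L k by (subst ln_mult) auto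
  finally have "lev p n (real ?t) \<le> ln 4 + lev p n (real k)" using k n p by (simp add: lev_eq)
  moreover have "ln 4 \<le> (2::real)"
  proof -
    have "(4::real) = 2\<^sup>2" by simp
    then have "ln (4::real) = 2 * ln 2" by (simp only: ln_realpow)
    then show ?thesis using ln_le_minus_one[of "2::real"] by simp
  qed
  moreover have "1 \<le> lev p n (real k)" using lev_ge_1[OF n p, of "real k"] k by simp
  ultimately show ?thesis using that[OF c] m by simp
qed

lemma score_ge: "t \<in> cand p n \<Longrightarrow> score_t p n g Y s v e t \<le> score p n g Y s v e"
  unfolding score_def by (intro Max_ge) (auto simp: cand_finite)

lemma score_le: "(\<And>t. t \<in> cand p n \<Longrightarrow> score_t p n g Y s v e t \<le> B) \<Longrightarrow> score p n g Y s v e \<le> B"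
  unfolding score_def using p_in_cand by (subst Max_le_iff) (auto simp: cand_finite)

lemma score_t_eq: "score_t p n g Y s v e t = (\<Sum>i\<in>{1..p}. excess (thr p n (real t)) (cusum_row Y s v e i)) - g t"
  by (simp add: score_t_def excess_def)

lemma excess_le_square: "0 \<le> a \<Longrightarrow> excess a z \<le> z\<^sup>2"
  using nu_nonneg[of a] by (simp add: excess_def)

text \<open>The price of thresholding one signal coordinate, whether it is kept (loss
  \<open>nu a\<close>) or removed (loss below \<open>a\<^sup>2\<close>).\<close>

lemma excess_ge_square: assumes "0 \<le> a" shows "z\<^sup>2 - (5 * a\<^sup>2 + 8) \<le> excess a z"
proof (cases "a \<le> \<bar>z\<bar>")
  case True
  have "nu a \<le> 5 * a\<^sup>2 + 8" using nu_le[OF assms] by (smt (verit) zero_le_power2)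
  then show ?thesis using True by (simp add: excess_def)
next
  case False
  then have "\<bar>z\<bar>\<^sup>2 \<le> a\<^sup>2" by (intro power_mono) auto
  then show ?thesis using False by (simp add: excess_def) (smt (verit) zero_le_power2)
qed

text \<open>For \<open>2 \<le> n\<close> the range of splits is finite and non-empty, so the
  \<open>LEAST\<close> in \<open>eta_hat\<close> is attained.\<close>

lemma eta_hat_maximises:
  assumes "2 \<le> n"
  shows "0 < eta_hat p n g Y" "eta_hat p n g Y < n"
    "\<And>w. 0 < w \<Longrightarrow> w < n \<Longrightarrow> score p n g Y 0 w n \<le> score p n g Y 0 (eta_hat p n g Y) n"
proof -
  let ?f = "\<lambda>v. score p n g Y 0 v n"
  have "1 \<in> {0<..<n}" using assms by simp
  then have "Max (?f ` {0<..<n}) \<in> ?f ` {0<..<n}" by (intro Max_in) blast+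
  then obtain v where v: "v \<in> {0<..<n}" "?f v = Max (?f ` {0<..<n})" by auto
  have "0 < v \<and> v < n \<and> (\<forall>w. 0 < w \<and> w < n \<longrightarrow> ?f w \<le> ?f v)"
    using v by (auto intro!: Max_ge)
  from LeastI[of "\<lambda>v. 0 < v \<and> v < n \<and> (\<forall>w. 0 < w \<and> w < n \<longrightarrow> ?f w \<le> ?f v)", OF this]
  show "0 < eta_hat p n g Y" "eta_hat p n g Y < n"
    "\<And>w. 0 < w \<Longrightarrow> w < n \<Longrightarrow> ?f w \<le> ?f (eta_hat p n g Y)"
    unfolding eta_hat_def by auto
qed

text \<open>For \<open>t = 2 ^ m\<close> the two exponentials decay geometrically from the lower and from the upper end of the dyadic
  grid, so that the union over the grid costs only a constant factor.\<close>

lemma cand_tail_sum: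
  fixes f :: "nat \<Rightarrow> real"
  assumes n: "2 \<le> n" and p: "1 \<le> p"
    and f0: "\<And>t. 0 \<le> f t"
    and f1: "\<And>t. t \<in> cand p n \<Longrightarrow> real t \<le> sqrt (real p * ln (real n)) \<Longrightarrow>
      f t \<le> 2 * (exp (- 12 * (ln (real n) + real t)) + exp (- 12 * (lev p n (real t) * ln (real n))))"
    and f2: "sqrt (real p * ln (real n)) < real p \<Longrightarrow> f p \<le> 2 * exp (- (12 * ln (real n)))"
  shows "(\<Sum>t\<in>cand p n. f t) \<le> 12 * exp (- (12 * ln (real n)))"
proof -
  define L where "L = ln (real n)"
  define E where "E = exp (- (12 * L))"
  have L: "1/2 \<le> L" using ln_ge_half[OF n] by (simp add: L_def)
  have pL: "0 < real p * L" using p L by simp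
  define I where "I = {m. real (2 ^ m) \<le> real_of_int \<lfloor>sqrt (real p * L)\<rfloor>}"
  have cand: "cand p n = (\<lambda>m. 2 ^ m) ` I \<union> {p}" unfolding cand_def I_def L_def by auto
  have finI: "finite I"
    using cand_finite[of p n] unfolding cand by (auto dest!: finite_imageD simp: inj_on_def)
  \<comment> \<open>The rate 6 is 12 times the lower bound \<open>1/2\<close> of
    \<open>L\<close>.\<close>
  have half: "exp (- (6 * real j)) \<le> (1/2) ^ j" for j
  proof -
    have "exp (-6::real) \<le> 1/2" using exp_ge_add_one_self[of "6::real"] by (simp add: exp_minus field_simps)
    then have "exp (-6::real) ^ j \<le> (1/2) ^ j" by (rule power_mono) simp
    then show ?thesis by (simp add: exp_of_nat_mult[symmetric] mult.commute)
  qed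
  have geo: "(\<Sum>m\<le>M. (1/2::real) ^ m) \<le> 2" for M
  proof -
    have "(\<Sum>m\<le>M. (1/2::real) ^ m) = 2 - (1/2) ^ M" by (induction M) auto
    then show ?thesis by simp
  qed
  have P: "(\<Sum>m\<in>I. f (2 ^ m)) \<le> 8 * E"
  proof (cases "I = {}")
    case False
    define M where "M = Max I"
    have "M \<in> I" unfolding M_def using False finI by simp
    then have "real (2 ^ M) \<le> sqrt (real p * L)" unfolding I_def by (simp add: le_floor_iff)
    then have "(real (2 ^ M))\<^sup>2 \<le> (sqrt (real p * L))\<^sup>2" by (rule power_mono) simp
    then have M2: "(2 ^ M)\<^sup>2 \<le> real p * L" using pL by simp
    have b: "f (2 ^ m) \<le> 2 * (E * (1/2) ^ m + E * (1/2) ^ (M - m))" if m: "m \<in> I" for m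
    proof -
      let ?t = "real (2 ^ m)"
      have mM: "m \<le> M" unfolding M_def using m finI by simp
      have ts: "?t \<le> sqrt (real p * L)" using m unfolding I_def by (simp add: le_floor_iff)
      have e1: "exp (- 12 * (L + ?t)) \<le> E * (1/2) ^ m"
      proof -
        have "real m \<le> ?t" by (simp add: less_imp_le of_nat_less_two_power)
        moreover have "- 12 * (L + b) \<le> - (12 * L) + - (6 * a)" if "a \<le> b" "0 \<le> a" for a b :: real
          using that by simp
        ultimately have "- 12 * (L + ?t) \<le> - (12 * L) + - (6 * real m)" using of_nat_0_le_iff by blast
        then have "exp (- 12 * (L + ?t)) \<le> exp (- (12 * L) + - (6 * real m))" by (rule exp_mono)
        also have "\<dots> = E * exp (- (6 * real m))" unfolding exp_add E_def ..
        also have "\<dots> \<le> E * (1/2) ^ m" by (intro mult_left_mono half) (simp add: E_def)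
        finally show ?thesis .
      qed
      \<comment> \<open>Each halving of \<open>t\<close> quadruples the argument of the logarithm
        and so adds at least 1 to \<open>lev\<close>, because \<open>exp 1 \<le> 4\<close>.\<close>
      have "real (M - m) \<le> ln (real p * L / ?t\<^sup>2)"
      proof -
        have "exp (1::real) \<le> 4" using exp_le by simp
        then have "exp (real (M - m)) \<le> 4 ^ (M - m)"
          using power_mono[of "exp (1::real)" 4 "M - m"] by (simp add: exp_of_nat_mult[symmetric])
        also have "\<dots> = (2 ^ M)\<^sup>2 / ?t\<^sup>2"
          using mM by (simp add: power_diff power2_eq_square power_mult_distrib[symmetric])
        also have "\<dots> \<le> real p * L / ?t\<^sup>2" using M2 by (intro divide_right_mono) auto
        finally show ?thesis using pL by (subst ln_ge_iff) auto
      qed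
      then have "1 + real (M - m) \<le> lev p n ?t" using lev_eq[OF n p, of ?t] by (simp add: L_def)
      then have "(1 + real (M - m)) * L \<le> lev p n ?t * L" using L by (intro mult_right_mono) auto
      moreover have "real (M - m) * (1/2) \<le> real (M - m) * L" using L by (intro mult_left_mono) auto
      ultimately have "exp (- 12 * (lev p n ?t * L)) \<le> exp (- (12 * L) + - (6 * real (M - m)))"
        by (simp add: algebra_simps)
      also have "\<dots> = E * exp (- (6 * real (M - m)))" unfolding exp_add E_def ..
      also have "\<dots> \<le> E * (1/2) ^ (M - m)" by (intro mult_left_mono half) (simp add: E_def)
      finally have e2: "exp (- 12 * (lev p n ?t * L)) \<le> E * (1/2) ^ (M - m)" .
      have "f (2 ^ m) \<le> 2 * (exp (- 12 * (L + ?t)) + exp (- 12 * (lev p n ?t * L)))"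
        unfolding L_def by (rule f1) (use m ts in \<open>auto simp: cand L_def\<close>)
      also have "\<dots> \<le> 2 * (E * (1/2) ^ m + E * (1/2) ^ (M - m))"
        by (intro mult_left_mono add_mono e1 e2) simp
      finally show ?thesis .
    qed
    have "(\<Sum>m\<in>I. f (2 ^ m)) \<le> (\<Sum>m\<in>I. 2 * (E * (1/2) ^ m + E * (1/2) ^ (M - m)))" by (rule sum_mono) (rule b)
    also have "\<dots> \<le> (\<Sum>m\<le>M. 2 * (E * (1/2) ^ m + E * (1/2) ^ (M - m)))"
      by (rule sum_mono2) (use finI in \<open>auto simp: M_def E_def\<close>)
    also have "\<dots> = 2 * E * ((\<Sum>m\<le>M. (1/2) ^ m) + (\<Sum>m\<le>M. (1/2) ^ (M - m)))"
      by (simp add: sum.distrib sum_distrib_left algebra_simps)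
    also have "(\<Sum>m\<le>M. (1/2::real) ^ (M - m)) = (\<Sum>m\<le>M. (1/2) ^ m)"
      by (rule sum.reindex_bij_witness[of _ "\<lambda>m. M - m" "\<lambda>m. M - m"]) auto
    also have "2 * E * ((\<Sum>m\<le>M. (1/2) ^ m) + (\<Sum>m\<le>M. (1/2) ^ m)) \<le> 2 * E * (2 + 2)"
      by (intro mult_left_mono add_mono geo) (simp add: E_def)
    finally show ?thesis by simp
  qed (simp add: E_def)
  \<comment> \<open>The candidate \<open>p\<close> is unthresholded when
    \<open>sqrt (p * L) < p\<close>; otherwise it lies in the range covered by
    \<open>f1\<close>.\<close>
  have fp: "f p \<le> 4 * E"
  proof (cases "sqrt (real p * L) < real p")
    case True
    then show ?thesis using f2 by (simp add: L_def E_def) (smt (verit) exp_ge_zero)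
  next
    case False
    have "f p \<le> 2 * (exp (- 12 * (L + real p)) + exp (- 12 * (lev p n (real p) * L)))"
      unfolding L_def using f1[OF p_in_cand] False by (simp add: L_def)
    also have "\<dots> \<le> 2 * (E + E)"
    proof (intro mult_left_mono add_mono)
      show "exp (- 12 * (L + real p)) \<le> E" unfolding E_def by simp
      have "1 \<le> lev p n (real p)" using False p by (intro lev_ge_1[OF n p]) (auto simp: L_def)
      then show "exp (- 12 * (lev p n (real p) * L)) \<le> E" unfolding E_def using L by simp
    qed simp
    finally show ?thesis by simp
  qed
  have "(\<Sum>t\<in>cand p n. f t) \<le> (\<Sum>t\<in>(\<lambda>m. 2 ^ m) ` I. f t) + (\<Sum>t\<in>{p}. f t)"
    unfolding cand using finI f0 by (intro order_trans[OF eq_refl[OF sum_Un]]) (auto intro: sum_nonneg)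
  also have "(\<Sum>t\<in>(\<lambda>m. 2 ^ m) ` I. f t) = (\<Sum>m\<in>I. f (2 ^ m))"
    by (subst sum.reindex) (auto simp: inj_on_def)
  finally show ?thesis using P fp by (simp add: E_def L_def)
qed

text \<open>The exponents \<open>m\<close> are at most \<open>2 * ln p\<close> because
  \<open>ln 2\<close> is at least \<open>1/2\<close>. Counting \<open>m = 0\<close> and the
  candidate \<open>p\<close> adds 2, which is absorbed as
  \<open>ln (exp 1 * p) = 1 + ln p\<close>.\<close>

lemma card_cand_le:
  assumes n: "2 \<le> n" and p: "1 \<le> p" "ln (real n) \<le> real p"
  shows "real (card (cand p n)) \<le> 2 * ln (exp 1 * real p)"
proof -
  define I where "I = {m::nat. real (2 ^ m) \<le> real_of_int \<lfloor>sqrt (real p * ln (real n))\<rfloor>}"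
  have cand: "cand p n = (\<lambda>m. 2 ^ m) ` I \<union> {p}" unfolding cand_def I_def by auto
  have sub: "I \<subseteq> {..nat \<lfloor>2 * ln (real p)\<rfloor>}"
  proof
    fix m assume "m \<in> I"
    then have "real (2 ^ m) \<le> sqrt (real p * ln (real n))" unfolding I_def by (simp add: le_floor_iff)
    also have "\<dots> \<le> sqrt (real p * real p)" using p by (intro real_sqrt_le_mono mult_left_mono) auto
    also have "\<dots> = real p" by simp
    finally have "ln (real (2 ^ m)) \<le> ln (real p)" using p by (subst ln_le_cancel_iff) auto
    then have "real m * ln 2 \<le> ln (real p)" by (simp add: ln_realpow)
    moreover have "real m * (1/2) \<le> real m * ln 2" using ln_ge_half[of 2] by (intro mult_left_mono) auto
    ultimately have "real m \<le> 2 * ln (real p)" by simp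
    then show "m \<in> {..nat \<lfloor>2 * ln (real p)\<rfloor>}" by (simp add: le_nat_iff le_floor_iff)
  qed
  have "card (cand p n) \<le> card ((\<lambda>m. 2 ^ m :: nat) ` I) + 1" unfolding cand using card_Un_le[of "(\<lambda>m. 2 ^ m) ` I" "{p}"] by simp
  also have "\<dots> \<le> card I + 1" using finite_subset[OF sub] by (simp add: card_image_le)
  also have "\<dots> \<le> (nat \<lfloor>2 * ln (real p)\<rfloor> + 1) + 1" using card_mono[OF _ sub] by simp
  finally have "real (card (cand p n)) \<le> real (nat \<lfloor>2 * ln (real p)\<rfloor>) + 2" by linarith
  also have "real (nat \<lfloor>2 * ln (real p)\<rfloor>) \<le> 2 * ln (real p)" using p by (intro of_nat_floor) auto
  also have "2 * ln (real p) + 2 = 2 * ln (exp 1 * real p)" using p by (subst ln_mult) auto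
  finally show ?thesis by simp
qed

section \<open>Localisation\<close>

locale single_change =
  fixes n p :: nat and \<sigma> :: real and \<mu> :: "nat \<Rightarrow> nat \<Rightarrow> real" and \<eta> :: nat
  assumes n: "2 \<le> n" and p: "1 \<le> p" and \<sigma>: "0 < \<sigma>" and \<eta>: "0 < \<eta>" "\<eta> < n"
    and change: "\<And>v. v \<in> {1..<n} \<Longrightarrow> (\<exists>i\<in>{1..p}. \<mu> i v \<noteq> \<mu> i (v+1)) \<longleftrightarrow> v = \<eta>"
begin

abbreviation "L \<equiv> ln (real n)"
abbreviation "N \<equiv> noise_measure p n \<sigma>"
abbreviation "Z \<equiv> noise_cusum n \<sigma>"
abbreviation "obs W \<equiv> \<lambda>i v. (\<mu> i v + W (i, v)) / \<sigma>"
text \<open>The constant is that of \<open>sparse_excess_tail\<close>, so the penalty cancels the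
  noise bound up to \<open>1408 * L\<close>.\<close>

abbreviation "pen \<equiv> \<lambda>t::nat. 1408 * rfun p n (real t)"

definition "th i = (\<mu> i (\<eta>+1) - \<mu> i \<eta>) / \<sigma>"
definition "supp = {i\<in>{1..p}. \<mu> i (\<eta>+1) - \<mu> i \<eta> \<noteq> 0}"
definition "k = card supp"
definition "gap v = (\<Sum>i\<in>{1..p}. (th i)\<^sup>2) * signal_gap n \<eta> v"
definition "cross v W = (\<Sum>i\<in>{1..p}. th i * (signal n \<eta> \<eta> * Z \<eta> i W - signal n \<eta> v * Z v i W))"
definition "C v W i = cusum_row (obs W) 0 v n i"

abbreviation "H \<equiv> hfun p n (real k)"

lemma supp_subset: "supp \<subseteq> {1..p}" by (auto simp: supp_def)

lemma k_bounds: "1 \<le> k" "k \<le> p"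
proof -
  have "supp \<noteq> {}" using change[of \<eta>] \<eta> by (auto simp: supp_def)
  then show "1 \<le> k" using finite_subset[OF supp_subset] by (simp add: k_def card_gt_0_iff Suc_le_eq)
  show "k \<le> p" using card_mono[OF _ supp_subset] by (simp add: k_def)
qed

lemma L_le_H: "L \<le> H" by (rule hfun_ge_ln[OF n k_bounds])

lemma L_pos: "1/2 \<le> L" by (rule ln_ge_half[OF n])

lemma mean_const: assumes "i \<in> {1..p}" "1 \<le> m" "m < n" "m \<noteq> \<eta>" shows "\<mu> i (Suc m) = \<mu> i m"
  using change[of m] assms by fastforce

lemma mean_step: assumes i: "i \<in> {1..p}" and t: "t \<in> {1..n}"
  shows "\<mu> i t = (if t \<le> \<eta> then \<mu> i \<eta> else \<mu> i (\<eta>+1))"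
proof (cases "t \<le> \<eta>")
  case True
  have "1 \<le> t" using t by simp
  from True have "\<mu> i t = \<mu> i \<eta>"
  proof (induction t rule: inc_induct)
    case (step m)
    show ?case using mean_const[OF i, of m] step \<open>1 \<le> t\<close> \<eta> by simp
  qed simp
  then show ?thesis using True by simp
next
  case False
  then have "\<eta> + 1 \<le> t" by simp
  then have "t \<le> n \<longrightarrow> \<mu> i t = \<mu> i (\<eta>+1)"
  proof (induction t rule: dec_induct)
    case (step m)
    then show ?case using mean_const[OF i, of m] by simp
  qed simp
  then show ?thesis using False t by simp
qed

lemma C_eq: assumes v: "0 < v" "v < n" and i: "i \<in> {1..p}"
  shows "C v W i = - signal n \<eta> v * th i + Z v i W"
proof -
  have "cusum (\<lambda>t. \<mu> i t / \<sigma>) 0 v n = - signal n \<eta> v * (\<mu> i (\<eta>+1) / \<sigma> - \<mu> i \<eta> / \<sigma>)"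
  proof (rule cusum_step[OF v \<eta>])
    fix t assume "t \<in> {1..n}"
    from mean_step[OF i this] show "\<mu> i t / \<sigma> = (if t \<le> \<eta> then \<mu> i \<eta> / \<sigma> else \<mu> i (\<eta>+1) / \<sigma>)"
      by (cases "t \<le> \<eta>") simp_all
  qed
  moreover have "C v W i = cusum (\<lambda>t. \<mu> i t / \<sigma>) 0 v n + Z v i W"
    unfolding C_def cusum_row_def noise_cusum_def cusum_eq_weighted_sum[OF v(2)] sum.distrib[symmetric]
    by (intro sum.cong) (auto simp: add_divide_distrib distrib_left)
  ultimately show ?thesis by (simp add: th_def diff_divide_distrib)
qed

lemma th_zero: "i \<in> {1..p} - supp \<Longrightarrow> th i = 0" by (auto simp: th_def supp_def)

text \<open>The cross terms combine to a Gaussian variable whose variance is of the order of \<open>gap v\<close> itself.\<close>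

lemma C_square_diff:
  assumes v: "0 < v" "v < n" and A: "supp \<subseteq> A" "A \<subseteq> {1..p}"
  shows "(\<Sum>i\<in>A. (C \<eta> W i)\<^sup>2) - (\<Sum>i\<in>A. (C v W i)\<^sup>2)
    = gap v - 2 * cross v W + (\<Sum>i\<in>A. (Z \<eta> i W)\<^sup>2) - (\<Sum>i\<in>A. (Z v i W)\<^sup>2)"
proof -
  \<comment> \<open>Off the support \<open>th\<close> vanishes. The identity thus serves both
    \<open>A = supp\<close> (sparse case) and the set of all rows (dense case).\<close>
  have r: "(\<Sum>i\<in>{1..p}. th i * f i) = (\<Sum>i\<in>A. th i * f i)" for f
  proof (rule sum.mono_neutral_right)
    show "\<forall>i\<in>{1..p} - A. th i * f i = 0" using A th_zero by (metis DiffE DiffI mult_zero_left subsetD)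
  qed (use A in auto)
  have "(\<Sum>i\<in>A. (C \<eta> W i)\<^sup>2) - (\<Sum>i\<in>A. (C v W i)\<^sup>2)
     = (\<Sum>i\<in>A. th i * (th i * signal_gap n \<eta> v) - 2 * (th i * (signal n \<eta> \<eta> * Z \<eta> i W - signal n \<eta> v * Z v i W))
        + (Z \<eta> i W)\<^sup>2 - (Z v i W)\<^sup>2)"
    unfolding sum_subtractf[symmetric]
  proof (rule sum.cong[OF refl])
    fix i assume "i \<in> A"
    then have i: "i \<in> {1..p}" using A by auto
    show "(C \<eta> W i)\<^sup>2 - (C v W i)\<^sup>2 = th i * (th i * signal_gap n \<eta> v)
      - 2 * (th i * (signal n \<eta> \<eta> * Z \<eta> i W - signal n \<eta> v * Z v i W)) + (Z \<eta> i W)\<^sup>2 - (Z v i W)\<^sup>2"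
      unfolding C_eq[OF v i] C_eq[OF \<eta> i] signal_gap_def by (simp add: power2_eq_square algebra_simps)
  qed
  also have "\<dots> = (\<Sum>i\<in>A. th i * (th i * signal_gap n \<eta> v)) - 2 * (\<Sum>i\<in>A. th i * (signal n \<eta> \<eta> * Z \<eta> i W - signal n \<eta> v * Z v i W))
        + (\<Sum>i\<in>A. (Z \<eta> i W)\<^sup>2) - (\<Sum>i\<in>A. (Z v i W)\<^sup>2)"
    by (simp add: sum.distrib sum_subtractf sum_distrib_left)
  also have "(\<Sum>i\<in>A. th i * (th i * signal_gap n \<eta> v)) = gap v"
    unfolding gap_def r[symmetric] sum_distrib_right by (simp add: power2_eq_square mult.assoc)
  also have "(\<Sum>i\<in>A. th i * (signal n \<eta> \<eta> * Z \<eta> i W - signal n \<eta> v * Z v i W)) = cross v W"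
    unfolding cross_def r[symmetric] ..
  finally show ?thesis .
qed

lemma score_t_C: "score_t p n pen (obs W) 0 v n t = (\<Sum>i\<in>{1..p}. excess (thr p n (real t)) (C v W i)) - pen t"
  unfolding score_t_eq C_def ..

text \<open>The deterministic half of the sparse case. At \<open>v\<close> every candidate must be
  bounded from above, while at \<open>\<eta>\<close> a single candidate near \<open>k\<close> gives
  the lower bound.\<close>

lemma sparse_gap_bound:
  assumes v: "0 < v" "v < n" and sparse: "real k \<le> sqrt (real p * L)"
    and E1: "\<And>w t. 0 < w \<Longrightarrow> w < n \<Longrightarrow> t \<in> cand p n \<Longrightarrow>
       \<bar>\<Sum>i\<in>{1..p} - supp. excess (thr p n (real t)) (Z w i W)\<bar> \<le> 1408 * (rfun p n (real t) + L)"
    and E2: "\<bar>\<Sum>i\<in>supp. excess 0 (Z v i W)\<bar> \<le> 1409 * (real k + L)"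
    and E3: "2 * cross v W \<le> gap v / 2 + 4 * (12 * L)"
    and max: "score p n pen (obs W) 0 \<eta> n \<le> score p n pen (obs W) 0 v n"
  shows "gap v \<le> 40000 * H"
proof -
  have split: "(\<Sum>i\<in>{1..p}. f i) = (\<Sum>i\<in>supp. f i) + (\<Sum>i\<in>{1..p} - supp. f i)" for f :: "nat \<Rightarrow> real"
    using sum.subset_diff[OF supp_subset, of f] by simp
  have off: "(\<Sum>i\<in>{1..p} - supp. excess a (C w W i)) = (\<Sum>i\<in>{1..p} - supp. excess a (Z w i W))"
    if "0 < w" "w < n" for w a
    by (intro sum.cong) (use th_zero C_eq[OF that] in auto)
  have up: "score p n pen (obs W) 0 v n \<le> (\<Sum>i\<in>supp. (C v W i)\<^sup>2) + 1408 * L"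
  proof (rule score_le)
    fix t assume t: "t \<in> cand p n"
    have a: "0 \<le> thr p n (real t)" using thr_nonneg[OF n p, of "real t"] cand_pos[OF p t] by simp
    have "(\<Sum>i\<in>supp. excess (thr p n (real t)) (C v W i)) \<le> (\<Sum>i\<in>supp. (C v W i)\<^sup>2)"
      by (intro sum_mono excess_le_square a)
    then show "score_t p n pen (obs W) 0 v n t \<le> (\<Sum>i\<in>supp. (C v W i)\<^sup>2) + 1408 * L"
      using E1[OF v t] unfolding score_t_C split off[OF v] by (simp add: abs_le_iff)
  qed
  obtain t where t: "t \<in> cand p n" "1 \<le> t" "t \<le> k" "lev p n (real t) \<le> 3 * lev p n (real k)"
    using dyadic_candidate[OF n p k_bounds(1) sparse] .
  have ts: "0 < real t" "real t \<le> sqrt (real p * L)" using t sparse by auto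
  have ks: "0 < real k" using k_bounds by simp
  note lt = sparse_level[OF n p ts] and lk = sparse_level(1)[OF n p ks sparse]
  have kH: "real k * lev p n (real k) \<le> H" by (rule hfun_ge_lev[OF n p k_bounds(1) sparse])
  have "real k * 1 \<le> real k * lev p n (real k)" using lk ks by (intro mult_left_mono) auto
  then have kH1: "real k \<le> H" using kH by simp
  have "real t * lev p n (real t) \<le> real k * (3 * lev p n (real k))"
    using t lt(1) by (intro mult_mono) auto
  then have rt: "rfun p n (real t) \<le> 4 * H" using lt(5) kH L_le_H by simp
  \<comment> \<open>The 84 comes from \<open>20 * lev + 8 \<le> 28 * lev\<close> at \<open>t\<close>
    and the factor 3 of the dyadic rounding; the 9 counts \<open>rfun \<le> 4 * H\<close> twice, as
    noise and as penalty, and \<open>L\<close> once.\<close>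
  have low: "(\<Sum>i\<in>supp. (C \<eta> W i)\<^sup>2) - 84 * H - 1408 * (9 * H) \<le> score p n pen (obs W) 0 \<eta> n"
  proof -
    let ?a = "thr p n (real t)"
    have a: "0 \<le> ?a" using thr_nonneg[OF n p ts(1)] .
    have "(\<Sum>i\<in>supp. (C \<eta> W i)\<^sup>2 - (5 * ?a\<^sup>2 + 8)) \<le> (\<Sum>i\<in>supp. excess ?a (C \<eta> W i))"
      by (intro sum_mono excess_ge_square a)
    then have "(\<Sum>i\<in>supp. (C \<eta> W i)\<^sup>2) - real k * (5 * ?a\<^sup>2 + 8) \<le> (\<Sum>i\<in>supp. excess ?a (C \<eta> W i))"
      by (simp add: sum_subtractf k_def)
    moreover have "5 * ?a\<^sup>2 + 8 \<le> 84 * lev p n (real k)" using lt(1,2) t(4) by linarith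
    then have "real k * (5 * ?a\<^sup>2 + 8) \<le> real k * (84 * lev p n (real k))" by (rule mult_left_mono) simp
    moreover have "- (1408 * (rfun p n (real t) + L)) \<le> (\<Sum>i\<in>{1..p} - supp. excess ?a (Z \<eta> i W))"
      using E1[OF \<eta> t(1)] by (simp add: abs_le_iff)
    ultimately have "(\<Sum>i\<in>supp. (C \<eta> W i)\<^sup>2) - 84 * H - 1408 * (9 * H) \<le> score_t p n pen (obs W) 0 \<eta> n t"
      unfolding score_t_C split off[OF \<eta>] using kH L_le_H rt by simp
    then show ?thesis using score_ge[OF t(1), of pen "obs W" 0 \<eta> n] by linarith
  qed
  have "(\<Sum>i\<in>supp. (Z v i W)\<^sup>2) = (\<Sum>i\<in>supp. excess 0 (Z v i W)) + real k"
    by (simp add: excess_0 sum_subtractf k_def)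
  then have "(\<Sum>i\<in>supp. (Z v i W)\<^sup>2) \<le> 2819 * H" using E2 kH1 L_le_H by (simp add: abs_le_iff)
  moreover have "0 \<le> (\<Sum>i\<in>supp. (Z \<eta> i W)\<^sup>2)" by (intro sum_nonneg) simp
  \<comment> \<open>Half the gap is at most \<open>84 + 9 * 1408 + 1408 + 48 + 2819 = 17031\<close>
    times \<open>H\<close>.\<close>
  ultimately show ?thesis
    using C_square_diff[OF v order_refl supp_subset, of W] E3 up low max L_le_H L_pos by linarith
qed

text \<open>Since \<open>k \<le> p\<close>, density of the change forces \<open>L \<le> p\<close>.
  The last bound keeps the Chernoff parameter in \<open>dense_defect_tail\<close>
  admissible.\<close>

lemma dense_regime: assumes dense: "sqrt (real p * L) < real k"
  shows "L \<le> real p" "sqrt (real p * L) < real p" "sqrt (real p * L) \<le> H"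
    "H = sqrt (real p * max L (ln (ln (exp 1 * real p))))" "max L (ln (ln (exp 1 * real p))) \<le> real p"
proof -
  show 1: "sqrt (real p * L) < real p" using dense k_bounds by linarith
  then have "real p * L \<le> (real p)\<^sup>2" by (intro sqrt_le_D) simp
  then show 2: "L \<le> real p" using p by (simp add: power2_eq_square)
  show 3: "H = sqrt (real p * max L (ln (ln (exp 1 * real p))))" using dense by (simp add: hfun_def)
  show "sqrt (real p * L) \<le> H" unfolding 3 by (intro real_sqrt_le_mono mult_left_mono) auto
  have "0 \<le> ln (real p)" using p by simp
  have "ln (exp 1 * real p) = 1 + ln (real p)" using p by (subst ln_mult) auto
  then have "ln (ln (exp 1 * real p)) = ln (1 + ln (real p))" by simp
  also have "\<dots> \<le> ln (real p)" using \<open>0 \<le> ln (real p)\<close> by (rule ln_add_one_self_le_self)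
  also have "\<dots> \<le> real p" using ln_le_minus_one[of "real p"] p by simp
  finally show "max L (ln (ln (exp 1 * real p))) \<le> real p" using 2 by simp
qed

text \<open>At \<open>\<eta>\<close> the candidate \<open>p\<close> has threshold 0, so its score is
  the centred sum of squares minus the penalty. At \<open>v\<close> every candidate exceeds the
  centred sum of squares by at most the sum of the defects.\<close>

lemma dense_gap_bound:
  assumes v: "0 < v" "v < n" and dense: "sqrt (real p * L) < real k"
    and E1: "\<And>w. 0 < w \<Longrightarrow> w < n \<Longrightarrow> \<bar>\<Sum>i\<in>{1..p}. excess 0 (Z w i W)\<bar> \<le> 1408 * sqrt (real p * L)"
    and E2: "\<And>t. t \<in> cand p n \<Longrightarrow> (\<Sum>i\<in>{1..p}. defect (thr p n (real t)) (C v W i)) \<le> 1408 * H"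
    and E3: "2 * cross v W \<le> gap v / 2 + 4 * (12 * L)"
    and max: "score p n pen (obs W) 0 \<eta> n \<le> score p n pen (obs W) 0 v n"
  shows "gap v \<le> 40000 * H"
proof -
  note dp = dense_regime[OF dense]
  have up: "score p n pen (obs W) 0 v n \<le> (\<Sum>i\<in>{1..p}. (C v W i)\<^sup>2) - real p + 1408 * H"
  proof (rule score_le)
    fix t assume t: "t \<in> cand p n"
    have "score_t p n pen (obs W) 0 v n t = (\<Sum>i\<in>{1..p}. (C v W i)\<^sup>2) - real p + (\<Sum>i\<in>{1..p}. defect (thr p n (real t)) (C v W i)) - pen t"
      unfolding score_t_C excess_eq by (simp add: sum.distrib sum_subtractf)
    then show "score_t p n pen (obs W) 0 v n t \<le> (\<Sum>i\<in>{1..p}. (C v W i)\<^sup>2) - real p + 1408 * H"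
      using E2[OF t] rfun_nonneg[OF n, of p "real t"] by linarith
  qed
  have "score_t p n pen (obs W) 0 \<eta> n p = (\<Sum>i\<in>{1..p}. (C \<eta> W i)\<^sup>2) - real p - 1408 * sqrt (real p * L)"
    unfolding score_t_C thr_dense[OF dp(2)] excess_0 using dp(2) by (simp add: sum_subtractf rfun_def)
  then have low: "(\<Sum>i\<in>{1..p}. (C \<eta> W i)\<^sup>2) - real p - 1408 * H \<le> score p n pen (obs W) 0 \<eta> n"
    using score_ge[OF p_in_cand, of p n pen "obs W" 0 \<eta> n] dp(3) by linarith
  have Z: "(\<Sum>i\<in>{1..p}. (Z w i W)\<^sup>2) = (\<Sum>i\<in>{1..p}. excess 0 (Z w i W)) + real p" for w
    by (simp add: excess_0 sum_subtractf)
  show ?thesis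
    using C_square_diff[OF v supp_subset order_refl, of W] E3 up low max L_le_H L_pos E1[OF v] E1[OF \<eta>] dp(3)
    unfolding Z by (simp only: abs_le_iff) linarith
qed

section \<open>Measurability of the scores and of the estimator\<close>

lemma Z_measurable: "w < n \<Longrightarrow> i \<in> {1..p} \<Longrightarrow> Z w i \<in> borel_measurable N"
  by (rule noise_cusum_measurable)

lemma C_measurable: assumes "0 < v" "v < n" "i \<in> {1..p}" shows "(\<lambda>W. C v W i) \<in> borel_measurable N"
  unfolding C_eq[OF assms] using Z_measurable[OF assms(2,3)] by simp

lemma score_measurable:
  assumes v: "0 < v" "v < n" shows "(\<lambda>W. score p n pen (obs W) 0 v n) \<in> borel_measurable N"
  unfolding score_def
proof (rule borel_measurable_Max[OF cand_finite])
  fix t assume "t \<in> cand p n"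
  show "(\<lambda>W. score_t p n pen (obs W) 0 v n t) \<in> borel_measurable N"
    unfolding score_t_C
    by (intro borel_measurable_diff borel_measurable_sum measurable_compose[OF C_measurable[OF v] excess_measurable]) auto
qed

lemma eta_hat_measurable: "(\<lambda>W. eta_hat p n pen (obs W)) \<in> measurable N (count_space UNIV)"
  unfolding eta_hat_def
proof (rule measurable_Least)
  fix v
  show "Measurable.pred N (\<lambda>W. 0 < v \<and> v < n \<and>
        (\<forall>w. 0 < w \<and> w < n \<longrightarrow> score p n pen (obs W) 0 w n \<le> score p n pen (obs W) 0 v n))"
  \<comment> \<open>The scores are known to be measurable only at interior splits; elsewhere the
    predicate is constantly false.\<close>
  proof (cases "0 < v \<and> v < n")
    case True
    have "Measurable.pred N (\<lambda>W. 0 < w \<and> w < n \<longrightarrow> score p n pen (obs W) 0 w n \<le> score p n pen (obs W) 0 v n)" for w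
    proof (cases "0 < w \<and> w < n")
      case w: True
      have "{W \<in> space N. score p n pen (obs W) 0 w n \<le> score p n pen (obs W) 0 v n} \<in> sets N"
        by (rule borel_measurable_le; rule score_measurable) (use w True in auto)
      then show ?thesis using w by (simp add: pred_def)
    next
      case False
      then have "(\<lambda>W. 0 < w \<and> w < n \<longrightarrow> score p n pen (obs W) 0 w n \<le> score p n pen (obs W) 0 v n) = (\<lambda>W. True)"
        by (intro ext) blast
      then show ?thesis by simp
    qed
    then show ?thesis using True by (simp only: simp_thms) (rule pred_intros_countable(1))
  next
    case False
    then have "(\<lambda>W. 0 < v \<and> v < n \<and>
        (\<forall>w. 0 < w \<and> w < n \<longrightarrow> score p n pen (obs W) 0 w n \<le> score p n pen (obs W) 0 v n)) = (\<lambda>W. False)"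
      by (intro ext) blast
    then show ?thesis by simp
  qed
qed

text \<open>A union bound over the splits costs a factor \<open>n\<close>, and
  \<open>15 / n ^ 10 \<le> 1 / n\<close> because \<open>15 \<le> 2 ^ 9\<close>. Off the bad events
  the gap bound applies to the maximiser and is inverted by \<open>signal_gap_ge\<close>.\<close>

lemma localisation_from_bad_events:
  assumes E: "\<And>v. v \<in> {1..<n} \<Longrightarrow> E v \<in> sets N"
    and P: "\<And>v. v \<in> {1..<n} \<Longrightarrow> measure N (E v) \<le> 15 * exp (- (11 * L))"
    and good: "\<And>v W. W \<in> space N \<Longrightarrow> (\<And>w. w \<in> {1..<n} \<Longrightarrow> W \<notin> E w) \<Longrightarrow> v \<in> {1..<n} \<Longrightarrow>
      score p n pen (obs W) 0 \<eta> n \<le> score p n pen (obs W) 0 v n \<Longrightarrow> gap v \<le> 40000 * H"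
    and snr: "90000 * H \<le> (\<Sum>i\<in>{1..p}. (th i)\<^sup>2) * real (min \<eta> (n - \<eta>))"
  shows "1 - 1 / real n \<le> measure N {W \<in> space N. 
     \<bar>real (eta_hat p n pen (obs W)) - real \<eta>\<bar> \<le> 80000 * H / (\<Sum>i\<in>{1..p}. (th i)\<^sup>2)}" (is "_ \<le> measure N ?T")
proof -
  interpret prob_space N using \<sigma> by (rule prob_space_noise)
  define \<Phi> where "\<Phi> = (\<Sum>i\<in>{1..p}. (th i)\<^sup>2)"
  have H: "0 < H" using L_le_H L_pos by linarith
  have \<Phi>: "0 < \<Phi>"
  proof (rule ccontr)
    assume "\<not> 0 < \<Phi>"
    then have "\<Phi> * real (min \<eta> (n - \<eta>)) \<le> 0" by (intro mult_nonpos_nonneg) auto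
    then show False using snr H by (simp add: \<Phi>_def)
  qed
  have T: "?T \<in> sets N"
    using eta_hat_measurable by measurable
  let ?B = "\<Union>v\<in>{1..<n}. E v"
  have "prob ?B \<le> (\<Sum>v\<in>{1..<n}. prob (E v))"
    by (rule finite_measure_subadditive_finite) (use E in auto)
  also have "\<dots> \<le> (\<Sum>v\<in>{1..<n}. 15 * exp (- (11 * L)))" by (intro sum_mono P)
  also have "\<dots> \<le> real n * (15 * exp (- (11 * L)))" by (simp add: of_nat_diff mult_right_mono)
  also have "\<dots> \<le> 1 / real n"
  proof -
    have "exp (11 * L) = real n ^ 11" using n exp_of_nat_mult[of 11 L] by simp
    then have e: "exp (- (11 * L)) = 1 / real n ^ 11" by (simp add: exp_minus field_simps)
    have "15 \<le> (2::real) ^ 9" by simp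
    also have "\<dots> \<le> real n ^ 9" using n by (intro power_mono) auto
    finally have "15 * (real n)\<^sup>2 \<le> real n ^ 9 * (real n)\<^sup>2" by (intro mult_right_mono) auto
    then show ?thesis unfolding e using n by (simp add: field_simps power2_eq_square eval_nat_numeral)
  qed
  finally have PB: "prob ?B \<le> 1 / real n" .
  have "space N - ?T \<subseteq> ?B"
  proof (rule ccontr)
    assume "\<not> space N - ?T \<subseteq> ?B"
    then obtain W where W: "W \<in> space N" "W \<notin> ?T" "\<And>w. w \<in> {1..<n} \<Longrightarrow> W \<notin> E w" by blast
    let ?v = "eta_hat p n pen (obs W)"
    note mx = eta_hat_maximises[OF n, where p=p and g=pen and Y="obs W"]
    have "gap ?v \<le> 40000 * H" by (rule good[OF W(1,3)]) (use mx \<eta> in auto)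
    moreover have "\<Phi> * (min \<bar>real ?v - real \<eta>\<bar> (real (min \<eta> (n - \<eta>))) / 2) \<le> gap ?v"
      unfolding gap_def \<Phi>_def[symmetric] using \<Phi> by (intro mult_left_mono signal_gap_ge mx \<eta>) auto
    ultimately have m: "\<Phi> * min \<bar>real ?v - real \<eta>\<bar> (real (min \<eta> (n - \<eta>))) \<le> 80000 * H" by simp
    have "\<Phi> * \<bar>real ?v - real \<eta>\<bar> \<le> 80000 * H"
    proof (cases "\<bar>real ?v - real \<eta>\<bar> \<le> real (min \<eta> (n - \<eta>))")
      case True
      then show ?thesis using m by (simp only: min_absorb1)
    \<comment> \<open>A minimum attained by the distance of \<open>\<eta>\<close> to the boundary
      would contradict \<open>snr\<close>, as 80000 is below 90000 and \<open>H\<close> is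
      positive.\<close>
    next
      case False
      then have "min \<bar>real ?v - real \<eta>\<bar> (real (min \<eta> (n - \<eta>))) = real (min \<eta> (n - \<eta>))" by (simp only: min_absorb2 linorder_not_le less_imp_le)
      then show ?thesis using m snr H unfolding \<Phi>_def[symmetric] by linarith
    qed
    then have "\<bar>real ?v - real \<eta>\<bar> \<le> 80000 * H / \<Phi>" using \<Phi> by (simp add: field_simps)
    then show False using W by (simp add: \<Phi>_def)
  qed
  then have "prob (space N - ?T) \<le> prob ?B" by (rule finite_measure_mono) (use E in auto)
  then show ?thesis using PB prob_compl[OF T] by linarith
qed

lemma exp_12_le_11: "exp (- (12 * L)) \<le> exp (- (11 * L))" using L_pos by simp

lemma cross_measurable: "0 < v \<Longrightarrow> v < n \<Longrightarrow> cross v \<in> borel_measurable N"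
  unfolding cross_def using \<eta>
  by (intro borel_measurable_sum borel_measurable_times borel_measurable_diff Z_measurable) auto

lemma excess_sum_measurable:
  assumes "v < n" "A \<subseteq> {1..p}"
  shows "(\<lambda>W. \<Sum>i\<in>A. excess a (Z v i W)) \<in> borel_measurable N"
  by (intro borel_measurable_sum measurable_compose[OF Z_measurable excess_measurable]) (use assms in auto)

lemma cross_tail:
  assumes "0 < v" "v < n"
  shows "measure N {W \<in> space N. gap v / 2 + 4 * (12 * L) \<le> 2 * cross v W} \<le> exp (- (12 * L))"
  using signal_noise_tail[OF \<sigma> assms \<eta>, of p th "12 * L"] unfolding gap_def cross_def .

lemma localisation:
  assumes snr: "90000 * H \<le> (\<Sum>i\<in>{1..p}. (th i)\<^sup>2) * real (min \<eta> (n - \<eta>))"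
  shows "1 - 1 / real n \<le> measure N {W \<in> space N. 
     \<bar>real (eta_hat p n pen (obs W)) - real \<eta>\<bar> \<le> 80000 * H / (\<Sum>i\<in>{1..p}. (th i)\<^sup>2)}"
proof -
  interpret prob_space N using \<sigma> by (rule prob_space_noise)
  define E3 where "E3 v = {W \<in> space N. gap v / 2 + 4 * (12 * L) \<le> 2 * cross v W}" for v
  have E3: "E3 v \<in> sets N" "prob (E3 v) \<le> exp (- (12 * L))" if "0 < v" "v < n" for v
    using cross_measurable[OF that] cross_tail[OF that] unfolding E3_def by auto
  show ?thesis
  proof (cases "real k \<le> sqrt (real p * L)")
    case sparse: True
    define E1 where "E1 v t = {W \<in> space N. 1408 * (rfun p n (real t) + L) \<le> \<bar>\<Sum>i\<in>{1..p} - supp. excess (thr p n (real t)) (Z v i W)\<bar>}" for v t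
    define E2 where "E2 v = {W \<in> space N. 1409 * (real (card supp) + L) \<le> \<bar>\<Sum>i\<in>supp. excess 0 (Z v i W)\<bar>}" for v
    have E1: "E1 v t \<in> sets N" if "v < n" for v t
      unfolding E1_def using excess_sum_measurable[OF that, of "{1..p} - supp"] by simp
    have E2: "E2 v \<in> sets N" if "v < n" for v
      unfolding E2_def using excess_sum_measurable[OF that supp_subset] by simp
    show ?thesis
    proof (rule localisation_from_bad_events[where E="\<lambda>v. (\<Union>t\<in>cand p n. E1 v t) \<union> E2 v \<union> E3 v", OF _ _ _ snr])
      fix v assume "v \<in> {1..<n}"
      then have v: "0 < v" "v < n" by auto
      have m1: "(\<Union>t\<in>cand p n. E1 v t) \<in> sets N" using E1[OF v(2)] cand_finite by auto
      then show "(\<Union>t\<in>cand p n. E1 v t) \<union> E2 v \<union> E3 v \<in> sets N" using E2[OF v(2)] E3(1)[OF v] by auto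
      have "prob (\<Union>t\<in>cand p n. E1 v t) \<le> (\<Sum>t\<in>cand p n. prob (E1 v t))"
        by (rule finite_measure_subadditive_finite) (use E1[OF v(2)] cand_finite in auto)
      also have "\<dots> \<le> 12 * exp (- (12 * L))"
      proof (rule cand_tail_sum[OF n p])
        fix t assume t: "t \<in> cand p n" "real t \<le> sqrt (real p * L)"
        show "prob (E1 v t) \<le> 2 * (exp (- 12 * (L + real t)) + exp (- 12 * (lev p n (real t) * L)))"
          unfolding E1_def using cand_pos[OF p t(1)] t(2) by (intro sparse_excess_tail[OF \<sigma> v p]) auto
      next
        assume d: "sqrt (real p * L) < real p"
        then have "real p * L \<le> (real p)\<^sup>2" by (intro sqrt_le_D) simp
        then have Lp: "L \<le> real p" using p by (simp add: power2_eq_square)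
        have "rfun p n (real p) = sqrt (real p * L)" using d by (simp add: rfun_def)
        \<comment> \<open>Adding the positive \<open>L\<close> raises the level, so the
          unthresholded tail bound covers this event.\<close>
        then have "E1 v p \<subseteq> {W \<in> space N. 1408 * sqrt (real p * L) \<le> \<bar>\<Sum>i\<in>{1..p} - supp. excess 0 (Z v i W)\<bar>}"
          unfolding E1_def thr_dense[OF d] using L_pos by auto
        then have "prob (E1 v p) \<le> prob {W \<in> space N. 1408 * sqrt (real p * L) \<le> \<bar>\<Sum>i\<in>{1..p} - supp. excess 0 (Z v i W)\<bar>}"
          by (rule finite_measure_mono) (use excess_sum_measurable[OF v(2), of "{1..p} - supp"] in simp)
        also have "\<dots> \<le> 2 * exp (- (12 * L))" by (rule dense_excess_tail[OF \<sigma> v _ Lp]) auto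
        finally show "prob (E1 v p) \<le> 2 * exp (- (12 * L))" .
      qed simp
      finally have "prob (\<Union>t\<in>cand p n. E1 v t) \<le> 12 * exp (- (12 * L))" .
      moreover have "prob (E2 v) \<le> 2 * exp (- (12 * L))"
        unfolding E2_def by (rule excess_0_tail[OF \<sigma> v supp_subset])
      moreover have "prob ((\<Union>t\<in>cand p n. E1 v t) \<union> E2 v \<union> E3 v) \<le> prob (\<Union>t\<in>cand p n. E1 v t) + prob (E2 v) + prob (E3 v)"
        using measure_Un_le[OF sets.Un[OF m1 E2[OF v(2)]] E3(1)[OF v]] measure_Un_le[OF m1 E2[OF v(2)]] by linarith
      ultimately show "prob ((\<Union>t\<in>cand p n. E1 v t) \<union> E2 v \<union> E3 v) \<le> 15 * exp (- (11 * L))"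
        using E3(2)[OF v] exp_12_le_11 by linarith
    next
      fix v W assume W: "W \<in> space N" and nb: "\<And>w. w \<in> {1..<n} \<Longrightarrow> W \<notin> (\<Union>t\<in>cand p n. E1 w t) \<union> E2 w \<union> E3 w"
        and v: "v \<in> {1..<n}" and max: "score p n pen (obs W) 0 \<eta> n \<le> score p n pen (obs W) 0 v n"
      show "gap v \<le> 40000 * H"
      proof (rule sparse_gap_bound[OF _ _ sparse _ _ _ max])
        fix w t assume "0 < w" "w < n" "t \<in> cand p n"
        then show "\<bar>\<Sum>i\<in>{1..p} - supp. excess (thr p n (real t)) (Z w i W)\<bar> \<le> 1408 * (rfun p n (real t) + L)"
          using nb[of w] W unfolding E1_def by auto
      next
        show "\<bar>\<Sum>i\<in>supp. excess 0 (Z v i W)\<bar> \<le> 1409 * (real k + L)"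
          using nb[OF v] W unfolding E2_def k_def by auto
        show "2 * cross v W \<le> gap v / 2 + 4 * (12 * L)"
          using nb[OF v] W unfolding E3_def by auto
      qed (use v in auto)
    qed
  next
    case False
    then have dense: "sqrt (real p * L) < real k" by simp
    define Q where "Q = max L (ln (ln (exp 1 * real p)))"
    note dp = dense_regime[OF dense, folded Q_def]
    have Q: "0 < Q" "L \<le> Q" using L_pos by (auto simp: Q_def)
    define E1 where "E1 v = {W \<in> space N. 1408 * sqrt (real p * L) \<le> \<bar>\<Sum>i\<in>{1..p}. excess 0 (Z v i W)\<bar>}" for v
    define E2 where "E2 v t = {W \<in> space N. 1408 * sqrt (real p * Q) \<le>
       (\<Sum>i\<in>{1..p}. defect (thr p n (real t)) (- signal n \<eta> v * th i + Z v i W))}" for v t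
    have E1: "E1 v \<in> sets N" if "v < n" for v
      unfolding E1_def using excess_sum_measurable[OF that order_refl] by simp
    have E2: "E2 v t \<in> sets N" if "v < n" for v t
    proof -
      have "(\<lambda>W. \<Sum>i\<in>{1..p}. defect (thr p n (real t)) (- signal n \<eta> v * th i + Z v i W)) \<in> borel_measurable N"
        by (intro borel_measurable_sum measurable_compose[OF _ defect_measurable] borel_measurable_add Z_measurable) (use that in auto)
      then show ?thesis unfolding E2_def by simp
    qed
    show ?thesis
    proof (rule localisation_from_bad_events[where E="\<lambda>v. (\<Union>t\<in>cand p n. E2 v t) \<union> E1 v \<union> E3 v", OF _ _ _ snr])
      fix v assume "v \<in> {1..<n}"
      then have v: "0 < v" "v < n" by auto
      have m1: "(\<Union>t\<in>cand p n. E2 v t) \<in> sets N" using E2[OF v(2)] cand_finite by auto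
      then show "(\<Union>t\<in>cand p n. E2 v t) \<union> E1 v \<union> E3 v \<in> sets N" using E1[OF v(2)] E3(1)[OF v] by auto
      have "prob (\<Union>t\<in>cand p n. E2 v t) \<le> (\<Sum>t\<in>cand p n. prob (E2 v t))"
        by (rule finite_measure_subadditive_finite) (use E2[OF v(2)] cand_finite in auto)
      also have "\<dots> \<le> (\<Sum>t\<in>cand p n. exp (- (12 * Q)))"
      proof (rule sum_mono)
        fix t assume t: "t \<in> cand p n"
        have "0 \<le> thr p n (real t)" using thr_nonneg[OF n p, of "real t"] cand_pos[OF p t] by simp
        then show "prob (E2 v t) \<le> exp (- (12 * Q))"
          unfolding E2_def by (rule dense_defect_tail[OF \<sigma> v _ Q(1) dp(5)])
      qed
      also have "\<dots> = real (card (cand p n)) * exp (- (12 * Q))" by simp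
      \<comment> \<open>The doubly logarithmic term in \<open>Q\<close> pays for the union over the
        candidates: their number is at most \<open>2 * exp Q\<close>, which lowers the exponent from
        12 to 11.\<close>
      also have "\<dots> \<le> (2 * exp Q) * exp (- (12 * Q))"
      proof (rule mult_right_mono)
        have "1 \<le> ln (exp 1 * real p)" using p by (subst ln_mult) auto
        then have "ln (exp 1 * real p) = exp (ln (ln (exp 1 * real p)))" by simp
        also have "\<dots> \<le> exp Q" by (simp add: Q_def)
        finally show "real (card (cand p n)) \<le> 2 * exp Q" using card_cand_le[OF n p dp(1)] by linarith
      qed simp
      also have "\<dots> = 2 * exp (- (11 * Q))" by (simp add: exp_add[symmetric])
      also have "\<dots> \<le> 2 * exp (- (11 * L))" using Q by simp
      finally have "prob (\<Union>t\<in>cand p n. E2 v t) \<le> 2 * exp (- (11 * L))" .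
      moreover have "prob (E1 v) \<le> 2 * exp (- (12 * L))"
        unfolding E1_def by (rule dense_excess_tail[OF \<sigma> v order_refl dp(1)])
      moreover have "prob ((\<Union>t\<in>cand p n. E2 v t) \<union> E1 v \<union> E3 v) \<le> prob (\<Union>t\<in>cand p n. E2 v t) + prob (E1 v) + prob (E3 v)"
        using measure_Un_le[OF sets.Un[OF m1 E1[OF v(2)]] E3(1)[OF v]] measure_Un_le[OF m1 E1[OF v(2)]] by linarith
      moreover have "0 \<le> exp (- (11 * L))" by simp
      ultimately show "prob ((\<Union>t\<in>cand p n. E2 v t) \<union> E1 v \<union> E3 v) \<le> 15 * exp (- (11 * L))"
        using E3(2)[OF v] exp_12_le_11 by linarith
    next
      fix v W assume W: "W \<in> space N" and nb: "\<And>w. w \<in> {1..<n} \<Longrightarrow> W \<notin> (\<Union>t\<in>cand p n. E2 w t) \<union> E1 w \<union> E3 w"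
        and v: "v \<in> {1..<n}" and max: "score p n pen (obs W) 0 \<eta> n \<le> score p n pen (obs W) 0 v n"
      have v': "0 < v" "v < n" using v by auto
      show "gap v \<le> 40000 * H"
      proof (rule dense_gap_bound[OF v' dense _ _ _ max])
        fix w assume "0 < w" "w < n"
        then show "\<bar>\<Sum>i\<in>{1..p}. excess 0 (Z w i W)\<bar> \<le> 1408 * sqrt (real p * L)"
          using nb[of w] W unfolding E1_def by auto
      next
        fix t assume t: "t \<in> cand p n"
        have "(\<Sum>i\<in>{1..p}. defect (thr p n (real t)) (C v W i))
          = (\<Sum>i\<in>{1..p}. defect (thr p n (real t)) (- signal n \<eta> v * th i + Z v i W))"
          by (intro sum.cong refl arg_cong[of _ _ "defect _"] C_eq v')
        then show "(\<Sum>i\<in>{1..p}. defect (thr p n (real t)) (C v W i)) \<le> 1408 * H"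
          using nb[OF v] W t unfolding E2_def dp(4) by auto
      next
        show "2 * cross v W \<le> gap v / 2 + 4 * (12 * L)"
          using nb[OF v] W unfolding E3_def by auto
      qed
    qed
  qed
qed

end

theorem theorem1:
  "\<exists>lam0 C\<^sub>0 C\<^sub>1 :: real. lam0 > 0 \<and> C\<^sub>0 > 0 \<and> C\<^sub>1 > 0 \<and>
    (\<forall>(n::nat) (p::nat) (\<sigma>::real) (\<mu>::nat \<Rightarrow> nat \<Rightarrow> real) (\<eta>::nat).
      n \<ge> 2 \<longrightarrow> p \<ge> 1 \<longrightarrow> \<sigma> > 0 \<longrightarrow> 0 < \<eta> \<longrightarrow> \<eta> < n \<longrightarrow>
      (\<forall>v\<in>{1..<n}. (\<exists>i\<in>{1..p}. \<mu> i v \<noteq> \<mu> i (v+1)) \<longleftrightarrow> v = \<eta>) \<longrightarrow>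
      (let \<theta> = (\<lambda>i. \<mu> i (\<eta>+1) - \<mu> i \<eta>);
           k = card {i\<in>{1..p}. \<theta> i \<noteq> 0};
           \<phi> = sqrt (\<Sum>i\<in>{1..p}. (\<theta> i)\<^sup>2);
           \<Delta> = min \<eta> (n - \<eta>);
           pen = (\<lambda>t. lam0 * rfun p n (real t))
       in \<phi>\<^sup>2 * real \<Delta> / \<sigma>\<^sup>2 \<ge> C\<^sub>0 * hfun p n (real k) \<longrightarrow>
          measure (noise_measure p n \<sigma>)
            {W \<in> space (noise_measure p n \<sigma>).
               \<bar>real (eta_hat p n pen (\<lambda>i v. (\<mu> i v + W (i, v)) / \<sigma>)) - real \<eta>\<bar>
                 \<le> C\<^sub>1 * \<sigma>\<^sup>2 / \<phi>\<^sup>2 * hfun p n (real k)}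
          \<ge> 1 - 1 / real n))"
\<comment> \<open>The penalty constant is that of \<open>pen\<close>. The radius 80000 is twice the
  gap constant 40000, by the factor 2 in \<open>signal_gap_ge\<close>, and 90000 is a value above
  it.\<close>
proof (rule exI[of _ 1408], rule exI[of _ 90000], rule exI[of _ 80000], intro conjI allI impI)
  fix n p :: nat and \<sigma> :: real and \<mu> :: "nat \<Rightarrow> nat \<Rightarrow> real" and \<eta> :: nat
  assume a: "n \<ge> 2" "p \<ge> 1" "\<sigma> > 0" "0 < \<eta>" "\<eta> < n"
    and c: "\<forall>v\<in>{1..<n}. (\<exists>i\<in>{1..p}. \<mu> i v \<noteq> \<mu> i (v+1)) \<longleftrightarrow> v = \<eta>"
  interpret single_change n p \<sigma> \<mu> \<eta> by unfold_locales (use a c in blast)+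
  define \<Phi> where "\<Phi> = (\<Sum>i\<in>{1..p}. (\<mu> i (\<eta>+1) - \<mu> i \<eta>)\<^sup>2)"
  have "(\<Sum>i\<in>{1..p}. (th i)\<^sup>2) = \<Phi> / \<sigma>\<^sup>2"
    by (simp add: th_def \<Phi>_def power_divide sum_divide_distrib)
  moreover have "(sqrt \<Phi>)\<^sup>2 = \<Phi>" unfolding \<Phi>_def by (simp add: sum_nonneg)
  ultimately show "let \<theta> = (\<lambda>i. \<mu> i (\<eta>+1) - \<mu> i \<eta>);
           k = card {i\<in>{1..p}. \<theta> i \<noteq> 0};
           \<phi> = sqrt (\<Sum>i\<in>{1..p}. (\<theta> i)\<^sup>2);
           \<Delta> = min \<eta> (n - \<eta>);
           pen = (\<lambda>t. 1408 * rfun p n (real t))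
       in \<phi>\<^sup>2 * real \<Delta> / \<sigma>\<^sup>2 \<ge> 90000 * hfun p n (real k) \<longrightarrow>
          measure (noise_measure p n \<sigma>)
            {W \<in> space (noise_measure p n \<sigma>).
               \<bar>real (eta_hat p n pen (\<lambda>i v. (\<mu> i v + W (i, v)) / \<sigma>)) - real \<eta>\<bar>
                 \<le> 80000 * \<sigma>\<^sup>2 / \<phi>\<^sup>2 * hfun p n (real k)}
          \<ge> 1 - 1 / real n"
    using localisation unfolding Let_def k_def supp_def \<Phi>_def[symmetric] by (simp add: mult_ac)
qed simp_all

end
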